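(* Let $(M,g)$ be a pseudo-Riemannian manifold of dimension $n\ge 3$, let $\boldsymbol{c}=[g]$ be its conformal class with conformal metric $\mathbf{g}_{ab}$, let $\sigma\in\Gamma(\mathcal{E}_+[1])$ be the scale with $g=\sigma^{-2}\mathbf{g}$, and let $I$ be the scale tractor of $\sigma$. Let $\gamma$ be a nowhere-null curve in $M$ and let $\Sigma\in\Gamma(\Lambda^3\mathcal{T}|_\gamma)$ be its associated 3-tractor. Then $\gamma$ is an unparametrised geodesic of $g$ if, and only if, $I\wedge\Sigma=0$ along $\gamma$.
   Context: Conventions. Manifolds are smooth, connected, of dimension $n\ge3$; $\boldsymbol{c}$ is a conformal class of metrics of any signature $(p,q)$. Abstract indices are used: $\mathcal{E}^a=TM$, $\mathcal{E}_a=T^*M$. Density bundles: $\mathcal{E}[w]=\big((\Lambda^nTM)^{2}\big)^{w/2n}$ for $w\in\mathbb{R}$, $\mathcal{E}_+[1]$ is the bundle of positive 1-densities, and $\mathcal{V}[w]=\mathcal{V}\otimes\mathcal{E}[w]$. The conformal metric $\mathbf{g}_{ab}\in\Gamma(\mathcal{E}_{(ab)}[2])$ is characterised by: each $g\in\boldsymbol{c}$ is $\sigma_g^{-2}\mathbf{g}$ for a unique $\sigma_g\in\Gamma(\mathcal{E}_+[1])$. Indices are raised and lowered with $\mathbf{g}$; the Levi-Civita connection $\nabla$ of $g\in\boldsymbol{c}$ acts on densities and preserves $\mathbf{g}$ and $\sigma_g$. $P_{ab}=\frac{1}{n-2}(\mathrm{Ric}_{ab}-J\mathbf{g}_{ab})$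 is the Schouten tensor of $g$, $J=\mathbf{g}^{ab}P_{ab}$, $\Delta=\mathbf{g}^{ab}\nabla_a\nabla_b$. Tractors. The standard tractor bundle $\mathcal{T}$ is the rank $n+2$ bundle which, for each $g\in\boldsymbol{c}$, is identified with $\mathcal{E}[1]\oplus\mathcal{E}_a[1]\oplus\mathcal{E}[-1]$; for $\hat g=e^{2\omega}g$, $\Upsilon=d\omega$, the triples are related by $(\hat\sigma,\hat\mu_a,\hat\rho)=(\sigma,\ \mu_a+\Upsilon_a\sigma,\ \rho-\Upsilon^b\mu_b-\tfrac12\Upsilon^b\Upsilon_b\sigma)$. In a scale $g$ write $V^A=\sigma Y^A+\mu^aZ^A{}_a+\rho X^A$ for the triple $(\sigma,\mu_a,\rho)$; $X^A\in\Gamma(\mathcal{E}^A[1])$ is conformally invariant. The tractor connection is $\nabla_a(\sigma,\mu_b,\rho)=(\nabla_a\sigma-\mu_a,\ \nabla_a\mu_b+\mathbf{g}_{ab}\rho+P_{ab}\sigma,\ \nabla_a\rho-P_{ab}\mu^b)$. Scale tractor of $\sigma\in\Gamma(\mathcal{E}[1])$: $I=\big(\sigma,\ \nabla_a\sigma,\ -\tfrac1n(\Delta\sigma+J\sigma)\big)\in\Gamma(\mathcal{T})$ (conformally invariant). Curves. A curve is a smooth regular map from an interval to $M$. For a nowhere-null curve with velocity $u^a$ put $\sigma_u=\sqrt{\pm\mathbf{g}_{ab}u^au^b}$ ($+$ if spacelike, $-$ if timelike), weighted velocity $\mathbf{u}^a=\sigma_u^{-1}u^a$ (so $\mathbf{u}^a\mathbf{u}_a=\pm1$),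 and, in a scale $g$, weighted acceleration $\mathbf{a}^b=\mathbf{u}^a\nabla_a\mathbf{u}^b$. With $U^A=\sigma_u\mathbf{u}^a\nabla_a(\sigma_u^{-1}X^A)$ and $A^B=\sigma_u\mathbf{u}^a\nabla_aU^B$, the 3-tractor of $\gamma$ is $$\Sigma^{ABC}=6\sigma_u^{-1}X^{[A}U^BA^{C]}=\pm6\,\mathbf{u}^cX^{[A}Y^BZ^{C]}{}_c+6\,\mathbf{u}^b\mathbf{a}^cX^{[A}Z^B{}_bZ^{C]}{}_c ,$$ which is conformally invariant and parametrisation independent. $I\wedge\Sigma:=I^{[A}\Sigma^{BCD]}$. $\gamma$ is an unparametrised geodesic of $g$ if $u^a\nabla_au^b\propto u^b$ along $\gamma$ for the Levi-Civita connection $\nabla$ of $g$. *)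

theory Defs
  imports "HOL-Analysis.Analysis"
begin

section \<open>Smooth manifolds\<close>

text \<open>
  The derivative is taken within \<open>S\<close>. The definition is used for open sets \<open>S\<close> and for relatively
  open subsets of a nondegenerate interval, where this derivative is unique.
\<close>

primrec Ck_on :: "nat \<Rightarrow> 'a::euclidean_space set \<Rightarrow> ('a \<Rightarrow> 'b::real_normed_vector) \<Rightarrow> bool" where
  "Ck_on 0 S f \<longleftrightarrow> continuous_on S f"
| "Ck_on (Suc k) S f \<longleftrightarrow>
     f differentiable_on S \<and> (\<forall>v. Ck_on k S (\<lambda>x. frechet_derivative f (at x within S) v))"

definition smooth_on :: "'a::euclidean_space set \<Rightarrow> ('a \<Rightarrow> 'b::real_normed_vector) \<Rightarrow> bool" where
  "smooth_on S f \<longleftrightarrow> (\<forall>k. Ck_on k S f)"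

type_synonym ('m, 'n) chart = "'m set \<times> ('m \<Rightarrow> real^'n)"

abbreviation chart_dom :: "('m, 'n::finite) chart \<Rightarrow> 'm set" where
  "chart_dom \<equiv> fst"

abbreviation coord :: "('m, 'n::finite) chart \<Rightarrow> 'm \<Rightarrow> real^'n" where
  "coord \<equiv> snd"

definition coord_inv :: "('m, 'n::finite) chart \<Rightarrow> real^'n \<Rightarrow> 'm" where
  "coord_inv \<phi> = inv_into (chart_dom \<phi>) (coord \<phi>)"

definition carrier :: "('m, 'n::finite) chart set \<Rightarrow> 'm set" where
  "carrier \<A> = (\<Union>\<phi>\<in>\<A>. chart_dom \<phi>)"

text \<open>The atlas need not be maximal. The dimension of the manifold is \<open>CARD('n)\<close>.\<close>

definition smooth_manifold ::
  "('m::{second_countable_topology,t2_space}, 'n::finite) chart set \<Rightarrow> bool" where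
  "smooth_manifold \<A> \<longleftrightarrow>
     connected (carrier \<A>) \<and>
     (\<forall>\<phi>\<in>\<A>. open (chart_dom \<phi>) \<and> open (coord \<phi> ` chart_dom \<phi>) \<and>
        homeomorphism (chart_dom \<phi>) (coord \<phi> ` chart_dom \<phi>) (coord \<phi>) (coord_inv \<phi>)) \<and>
     (\<forall>\<phi>\<in>\<A>. \<forall>\<psi>\<in>\<A>.
        smooth_on (coord \<phi> ` (chart_dom \<phi> \<inter> chart_dom \<psi>)) (coord \<psi> \<circ> coord_inv \<phi>))"

definition jac :: "('m, 'n::finite) chart \<Rightarrow> ('m, 'n) chart \<Rightarrow> 'm \<Rightarrow> real^'n^'n" where
  "jac \<phi> \<psi> p = matrix (frechet_derivative (coord \<psi> \<circ> coord_inv \<phi>) (at (coord \<phi> p)))"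

definition partial :: "('m, 'n::finite) chart \<Rightarrow> 'n \<Rightarrow> ('m \<Rightarrow> real) \<Rightarrow> 'm \<Rightarrow> real" where
  "partial \<phi> a f p = frechet_derivative (f \<circ> coord_inv \<phi>) (at (coord \<phi> p)) (axis a 1)"

definition smooth_in :: "('m, 'n::finite) chart \<Rightarrow> ('m \<Rightarrow> 'b::real_normed_vector) \<Rightarrow> bool" where
  "smooth_in \<phi> f \<longleftrightarrow> smooth_on (coord \<phi> ` chart_dom \<phi>) (f \<circ> coord_inv \<phi>)"

lemma smooth_on_differentiable:
  assumes "smooth_on S f" "open S" "x \<in> S"
  shows "f differentiable (at x)"
proof -
  have "Ck_on (Suc 0) S f"
    using assms(1) unfolding smooth_on_def by blast
  then have "f differentiable (at x within S)"
    using assms(3) by (simp add: differentiable_on_def)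
  then show ?thesis
    using at_within_open[OF assms(3,2)] by metis
qed


lemma Ck_on_SucI:
  assumes "open S" "\<And>x. x \<in> S \<Longrightarrow> (f has_derivative f' x) (at x)"
    and "\<And>v. Ck_on k S (\<lambda>x. frechet_derivative f (at x within S) v)"
  shows "Ck_on (Suc k) S f"
proof -
  have "f differentiable (at x within S)" if "x \<in> S" for x
    using assms(2)[OF that] differentiableI differentiable_at_withinI by blast
  then show ?thesis
    using assms(3) by (simp add: differentiable_on_def)
qed

lemma frechet_derivative_within_open:
  assumes "open S" "x \<in> S" "(f has_derivative f') (at x)"
  shows "frechet_derivative f (at x within S) = f'"
  using frechet_derivative_at[OF assms(3)] at_within_open[OF assms(2,1)] by metis

lemma Ck_on_SucD:
  assumes "open S" "Ck_on (Suc k) S f"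
  shows "x \<in> S \<Longrightarrow> (f has_derivative frechet_derivative f (at x)) (at x)"
    and "Ck_on k S (\<lambda>x. frechet_derivative f (at x within S) v)"
proof -
  assume x: "x \<in> S"
  have "f differentiable (at x within S)"
    using assms(2) x by (simp add: differentiable_on_def)
  then show "(f has_derivative frechet_derivative f (at x)) (at x)"
    using at_within_open[OF x assms(1)] frechet_derivative_works by metis
next
  show "Ck_on k S (\<lambda>x. frechet_derivative f (at x within S) v)"
    using assms(2) by simp
qed

lemma Ck_on_cong:
  assumes "open S"
  shows "\<forall>x\<in>S. f x = g x \<Longrightarrow> Ck_on k S f \<Longrightarrow> Ck_on k S g"
proof (induction k arbitrary: f g)
  case 0
  have "continuous_on S f = continuous_on S g"
    by (rule continuous_on_cong) (use 0(1) in blast)+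
  then show ?case
    using 0(2) unfolding Ck_on.simps(1) by blast
next
  case (Suc k)
  have hd: "(g has_derivative frechet_derivative f (at x)) (at x)" if "x \<in> S" for x
  proof (rule has_derivative_transform_within_open[OF _ assms that])
    show "(f has_derivative frechet_derivative f (at x)) (at x)"
      by (rule Ck_on_SucD(1)[OF assms Suc.prems(2) that])
  qed (use Suc.prems(1) in blast)
  show ?case
  proof (rule Ck_on_SucI[OF assms hd])
    fix v
    show "Ck_on k S (\<lambda>x. frechet_derivative g (at x within S) v)"
    proof (rule Suc.IH[OF _ Ck_on_SucD(2)[OF assms Suc.prems(2)]], rule ballI)
      fix x assume x: "x \<in> S"
      show "frechet_derivative f (at x within S) v = frechet_derivative g (at x within S) v"
        unfolding frechet_derivative_within_open[OF assms x hd[OF x]]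
          frechet_derivative_within_open[OF assms x Ck_on_SucD(1)[OF assms Suc.prems(2) x]] ..
    qed
  qed
qed

lemma Ck_on_diff:
  assumes "open S"
  shows "Ck_on k S f \<Longrightarrow> Ck_on k S g \<Longrightarrow> Ck_on k S (\<lambda>x. f x - g x)"
proof (induction k arbitrary: f g)
  case 0
  then show ?case
    unfolding Ck_on.simps(1) by (rule continuous_on_diff)
next
  case (Suc k)
  note f = Ck_on_SucD[OF assms Suc.prems(1)] and g = Ck_on_SucD[OF assms Suc.prems(2)]
  note hd = has_derivative_diff[OF f(1) g(1)]
  show ?case
  proof (rule Ck_on_SucI[OF assms hd])
    fix v
    show "Ck_on k S (\<lambda>x. frechet_derivative (\<lambda>x. f x - g x) (at x within S) v)"
    proof (rule Ck_on_cong[OF assms _ Suc.IH[OF f(2)[of v] g(2)[of v]]], rule ballI)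
      fix x assume x: "x \<in> S"
      show "frechet_derivative f (at x within S) v - frechet_derivative g (at x within S) v =
          frechet_derivative (\<lambda>x. f x - g x) (at x within S) v"
        unfolding frechet_derivative_within_open[OF assms x hd[OF x x]]
          frechet_derivative_within_open[OF assms x f(1)[OF x]]
          frechet_derivative_within_open[OF assms x g(1)[OF x]] ..
    qed
  qed
qed

lemma jac_inverse:
  assumes "smooth_manifold \<A>" "\<phi> \<in> \<A>" "\<psi> \<in> \<A>" "p \<in> chart_dom \<phi> \<inter> chart_dom \<psi>"
  shows "jac \<phi> \<psi> p ** jac \<psi> \<phi> p = mat 1"
proof -
  have hom: "homeomorphism (chart_dom \<eta>) (coord \<eta> ` chart_dom \<eta>) (coord \<eta>) (coord_inv \<eta>)"
    and op: "open (chart_dom \<eta>)" "open (coord \<eta> ` chart_dom \<eta>)" if "\<eta> \<in> \<A>" for \<eta>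
    using assms(1) that unfolding smooth_manifold_def by auto
  have inv: "coord_inv \<eta> (coord \<eta> q) = q" if "\<eta> \<in> \<A>" "q \<in> chart_dom \<eta>" for \<eta> q
    using hom[OF that(1)] that(2) by (auto simp: homeomorphism_def)
  have opi: "open (coord \<eta> ` (chart_dom \<eta> \<inter> chart_dom \<theta>))" if "\<eta> \<in> \<A>" "\<theta> \<in> \<A>" for \<eta> \<theta>
  proof -
    have "openin (top_of_set (coord \<eta> ` chart_dom \<eta>)) (coord \<eta> ` (chart_dom \<eta> \<inter> chart_dom \<theta>))"
      using homeomorphism_imp_open_map[OF hom[OF that(1)]] op(1)[OF that(2)]
      by (simp add: openin_open_Int)
    then show ?thesis
      using op(2)[OF that(1)] openin_open_trans by metis
  qed
  have df: "(coord \<theta> \<circ> coord_inv \<eta>) differentiable (at (coord \<eta> p))"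
    if "\<eta> \<in> \<A>" "\<theta> \<in> \<A>" "p \<in> chart_dom \<eta> \<inter> chart_dom \<theta>" for \<eta> \<theta>
  proof (rule smooth_on_differentiable[OF _ opi[OF that(1,2)]])
    show "smooth_on (coord \<eta> ` (chart_dom \<eta> \<inter> chart_dom \<theta>)) (coord \<theta> \<circ> coord_inv \<eta>)"
      using assms(1) that(1,2) unfolding smooth_manifold_def by blast
    show "coord \<eta> p \<in> coord \<eta> ` (chart_dom \<eta> \<inter> chart_dom \<theta>)"
      using that(3) by blast
  qed
  let ?f = "coord \<phi> \<circ> coord_inv \<psi>" and ?g = "coord \<psi> \<circ> coord_inv \<phi>"
  have fp: "?f (coord \<psi> p) = coord \<phi> p"
    using inv[OF assms(3)] assms(4) by simp
  have f: "(?f has_derivative frechet_derivative ?f (at (coord \<psi> p))) (at (coord \<psi> p))"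
    and g: "(?g has_derivative frechet_derivative ?g (at (coord \<phi> p))) (at (?f (coord \<psi> p)))"
    using df[OF assms(3,2)] df[OF assms(2,3)] assms(4)
    unfolding fp by (simp_all add: frechet_derivative_works)
  have "(?g \<circ> ?f has_derivative
      frechet_derivative ?g (at (coord \<phi> p)) \<circ> frechet_derivative ?f (at (coord \<psi> p))) (at (coord \<psi> p))"
    by (rule diff_chain_at[OF f g])
  moreover have "(?g \<circ> ?f has_derivative id) (at (coord \<psi> p))"
  proof (rule has_derivative_transform_within_open[OF has_derivative_id opi[OF assms(3,2)]])
    show "coord \<psi> p \<in> coord \<psi> ` (chart_dom \<psi> \<inter> chart_dom \<phi>)"
      using assms(4) by auto
    fix x assume "x \<in> coord \<psi> ` (chart_dom \<psi> \<inter> chart_dom \<phi>)"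
    then obtain q where q: "q \<in> chart_dom \<psi>" "q \<in> chart_dom \<phi>" "x = coord \<psi> q"
      by blast
    show "id x = (?g \<circ> ?f) x"
      unfolding q(3) o_apply id_apply inv[OF assms(3) q(1)] inv[OF assms(2) q(2)] ..
  qed
  ultimately have "frechet_derivative ?g (at (coord \<phi> p)) \<circ> frechet_derivative ?f (at (coord \<psi> p)) = id"
    using has_derivative_unique by blast
  then show ?thesis
    unfolding jac_def
    using has_derivative_linear[OF f] has_derivative_linear[OF g]
    by (simp add: matrix_compose[symmetric] matrix_id_mat_1)
qed

lemma det_jac_nonzero:
  assumes "smooth_manifold \<A>" "\<phi> \<in> \<A>" "\<psi> \<in> \<A>" "p \<in> chart_dom \<phi> \<inter> chart_dom \<psi>"
  shows "det (jac \<phi> \<psi> p) \<noteq> 0"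
proof -
  have "det (jac \<phi> \<psi> p) * det (jac \<psi> \<phi> p) = 1"
    using jac_inverse[OF assms] by (metis det_I det_mul)
  then show ?thesis
    by auto
qed

section \<open>Densities, metrics and conformal classes\<close>

text \<open>
  Tensor fields are given by their components in every chart. The component of a section of
  \<open>\<E>[w] = ((\<Lambda>\<^sup>n TM)\<^sup>2)\<close> to the power \<open>w/2n\<close> is taken with respect to the trivialisation given by
  \<open>(\<partial>\<^sub>1 \<and> \<dots> \<and> \<partial>\<^sub>n)\<^sup>2\<close>; a change of chart with Jacobian matrix \<open>D\<close> multiplies this component by
  \<open>\<bar>det D\<bar>\<close> to the power \<open>w/n\<close>. Values at points outside the domain of the chart are irrelevant.
\<close>

type_synonym ('m, 'n) scalar_field = "('m, 'n) chart \<Rightarrow> 'm \<Rightarrow> real"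
type_synonym ('m, 'n) form_field = "('m, 'n) chart \<Rightarrow> 'm \<Rightarrow> real^'n^'n"

definition weight_factor ::
  "real \<Rightarrow> ('m, 'n::finite) chart \<Rightarrow> ('m, 'n) chart \<Rightarrow> 'm \<Rightarrow> real" where
  "weight_factor w \<phi> \<psi> p = \<bar>det (jac \<phi> \<psi> p)\<bar> powr (w / real CARD('n))"

definition density :: "('m, 'n::finite) chart set \<Rightarrow> real \<Rightarrow> ('m, 'n) scalar_field \<Rightarrow> bool" where
  "density \<A> w s \<longleftrightarrow>
     (\<forall>\<phi>\<in>\<A>. smooth_in \<phi> (s \<phi>)) \<and>
     (\<forall>\<phi>\<in>\<A>. \<forall>\<psi>\<in>\<A>. \<forall>p \<in> chart_dom \<phi> \<inter> chart_dom \<psi>.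
        s \<psi> p = weight_factor w \<phi> \<psi> p * s \<phi> p)"

definition positive_density ::
  "('m, 'n::finite) chart set \<Rightarrow> real \<Rightarrow> ('m, 'n) scalar_field \<Rightarrow> bool" where
  "positive_density \<A> w s \<longleftrightarrow>
     density \<A> w s \<and> (\<forall>\<phi>\<in>\<A>. \<forall>p \<in> chart_dom \<phi>. s \<phi> p > 0)"

text \<open>Sections of \<open>\<E>\<^bsub>(ab)\<^esub>[w]\<close>.\<close>

definition symmetric_form ::
  "('m, 'n::finite) chart set \<Rightarrow> real \<Rightarrow> ('m, 'n) form_field \<Rightarrow> bool" where
  "symmetric_form \<A> w h \<longleftrightarrow>
     (\<forall>\<phi>\<in>\<A>. smooth_in \<phi> (h \<phi>) \<and> (\<forall>p \<in> chart_dom \<phi>. transpose (h \<phi> p) = h \<phi> p)) \<and>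
     (\<forall>\<phi>\<in>\<A>. \<forall>\<psi>\<in>\<A>. \<forall>p \<in> chart_dom \<phi> \<inter> chart_dom \<psi>.
        transpose (jac \<phi> \<psi> p) ** h \<psi> p ** jac \<phi> \<psi> p = weight_factor w \<phi> \<psi> p *\<^sub>R h \<phi> p)"

definition pseudo_riemannian_metric ::
  "('m, 'n::finite) chart set \<Rightarrow> ('m, 'n) form_field \<Rightarrow> bool" where
  "pseudo_riemannian_metric \<A> g \<longleftrightarrow>
     symmetric_form \<A> 0 g \<and> (\<forall>\<phi>\<in>\<A>. \<forall>p \<in> chart_dom \<phi>. invertible (g \<phi> p))"

definition conformal_change ::
  "('m, 'n::finite) chart set \<Rightarrow> ('m \<Rightarrow> real) \<Rightarrow> ('m, 'n) form_field \<Rightarrow> ('m, 'n) form_field \<Rightarrow> bool"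
  where
  "conformal_change \<A> \<omega> g h \<longleftrightarrow>
     (\<forall>\<phi>\<in>\<A>. smooth_in \<phi> \<omega> \<and> (\<forall>p \<in> chart_dom \<phi>. h \<phi> p = exp (2 * \<omega> p) *\<^sub>R g \<phi> p))"

definition conformal_class ::
  "('m, 'n::finite) chart set \<Rightarrow> ('m, 'n) form_field \<Rightarrow> ('m, 'n) form_field set" where
  "conformal_class \<A> g = {h. pseudo_riemannian_metric \<A> h \<and> (\<exists>\<omega>. conformal_change \<A> \<omega> g h)}"

text \<open>\<open>g = \<sigma>\<^sup>-\<^sup>2 G\<close>.\<close>

definition scale_of ::
  "('m, 'n::finite) chart set \<Rightarrow> ('m, 'n) form_field \<Rightarrow> ('m, 'n) form_field \<Rightarrow>
   ('m, 'n) scalar_field \<Rightarrow> bool" where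
  "scale_of \<A> G g \<sigma> \<longleftrightarrow> positive_density \<A> 1 \<sigma> \<and>
     (\<forall>\<phi>\<in>\<A>. \<forall>p \<in> chart_dom \<phi>. g \<phi> p = inverse ((\<sigma> \<phi> p)\<^sup>2) *\<^sub>R G \<phi> p)"

text \<open>
  Multiplying \<open>G\<close> by a positive function would preserve the existence of scales. The normalisation is
  the one inherent in the definition of \<open>\<E>[w]\<close>: the determinant of an element of \<open>\<E>\<^bsub>(ab)\<^esub>[2]\<close> is a
  number, since \<open>(\<Lambda>\<^sup>n T\<^sup>*M)\<^sup>2\<close> is \<open>\<E>[-2n]\<close>, and that of the conformal metric is \<open>1\<close> or \<open>-1\<close>. Thus
  \<open>G\<close> is \<open>\<bar>det g\<bar>\<close> to the power \<open>-1/n\<close> times \<open>g\<close>, and it is parallel for the Levi-Civita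
  connection of each \<open>g \<in> c\<close>. Scales are unique because they are positive.
\<close>

definition conformal_metric ::
  "('m, 'n::finite) chart set \<Rightarrow> ('m, 'n) form_field set \<Rightarrow> ('m, 'n) form_field \<Rightarrow> bool" where
  "conformal_metric \<A> c G \<longleftrightarrow>
     symmetric_form \<A> 2 G \<and>
     (\<forall>\<phi>\<in>\<A>. \<forall>p \<in> chart_dom \<phi>. \<bar>det (G \<phi> p)\<bar> = 1) \<and>
     (\<forall>g\<in>c. \<exists>\<sigma>. scale_of \<A> G g \<sigma>)"

lemma scale_of_unique:
  assumes "scale_of \<A> G g \<sigma>" "scale_of \<A> G g \<tau>" "conformal_metric \<A> c G"
    and "\<phi> \<in> \<A>" "p \<in> chart_dom \<phi>"
  shows "\<sigma> \<phi> p = \<tau> \<phi> p"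
proof -
  have pos: "\<sigma> \<phi> p > 0" "\<tau> \<phi> p > 0"
    using assms by (auto simp: scale_of_def positive_density_def)
  have "inverse ((\<sigma> \<phi> p)\<^sup>2) *\<^sub>R G \<phi> p = inverse ((\<tau> \<phi> p)\<^sup>2) *\<^sub>R G \<phi> p"
    using assms(1,2,4,5) unfolding scale_of_def by metis
  moreover have "G \<phi> p \<noteq> 0"
  proof
    assume "G \<phi> p = 0"
    then have "det (G \<phi> p) = 0"
      by (metis det_0 mat_0)
    moreover have "\<bar>det (G \<phi> p)\<bar> = 1"
      using assms(3-5) by (simp add: conformal_metric_def)
    ultimately show False
      by simp
  qed
  ultimately have "inverse ((\<sigma> \<phi> p)\<^sup>2) = inverse ((\<tau> \<phi> p)\<^sup>2)"
    unfolding scaleR_cancel_right by blast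
  then have "(\<sigma> \<phi> p)\<^sup>2 = (\<tau> \<phi> p)\<^sup>2"
    by simp
  then show ?thesis
    using pos by (simp add: power2_eq_iff_nonneg)
qed

section \<open>The Levi-Civita connection and curvature\<close>

text \<open>\<open>christoffel g \<phi> p a b c\<close> is \<open>\<Gamma>\<^sup>a\<^bsub>bc\<^esub>\<close>, so that \<open>\<nabla>\<^sub>b v\<^sup>a = \<partial>\<^sub>b v\<^sup>a + \<Gamma>\<^sup>a\<^bsub>bc\<^esub> v\<^sup>c\<close>.\<close>

definition christoffel ::
  "('m, 'n::finite) form_field \<Rightarrow> ('m, 'n) chart \<Rightarrow> 'm \<Rightarrow> 'n \<Rightarrow> 'n \<Rightarrow> 'n \<Rightarrow> real" where
  "christoffel g \<phi> p a b c = 1/2 * (\<Sum>d\<in>UNIV. matrix_inv (g \<phi> p) $ a $ d *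
     (partial \<phi> b (\<lambda>q. g \<phi> q $ d $ c) p + partial \<phi> c (\<lambda>q. g \<phi> q $ d $ b) p
      - partial \<phi> d (\<lambda>q. g \<phi> q $ b $ c) p))"

text \<open>
  The induced connection on \<open>\<Lambda>\<^sup>n TM\<close> has connection form \<open>\<Gamma>\<^sup>b\<^bsub>ab\<^esub>\<close> in the frame
  \<open>\<partial>\<^sub>1 \<and> \<dots> \<and> \<partial>\<^sub>n\<close>, hence that on \<open>\<E>[w]\<close> has connection form \<open>(w/n) \<Gamma>\<^sup>b\<^bsub>ab\<^esub>\<close>.
\<close>

definition density_form ::
  "real \<Rightarrow> ('m, 'n::finite) form_field \<Rightarrow> ('m, 'n) chart \<Rightarrow> 'm \<Rightarrow> real^'n" where
  "density_form w g \<phi> p = (\<chi> a. w / real CARD('n) * (\<Sum>b\<in>UNIV. christoffel g \<phi> p b a b))"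

definition nabla_density ::
  "real \<Rightarrow> ('m, 'n::finite) form_field \<Rightarrow> ('m, 'n) chart \<Rightarrow> ('m \<Rightarrow> real) \<Rightarrow> 'm \<Rightarrow> real^'n" where
  "nabla_density w g \<phi> s p = (\<chi> a. partial \<phi> a s p + density_form w g \<phi> p $ a * s p)"

text \<open>\<open>nabla_covector w g \<phi> \<mu> p $ a $ b\<close> is \<open>\<nabla>\<^sub>a \<mu>\<^sub>b\<close> for a section \<open>\<mu>\<close> of \<open>\<E>\<^sub>b[w]\<close>.\<close>

definition nabla_covector ::
  "real \<Rightarrow> ('m, 'n::finite) form_field \<Rightarrow> ('m, 'n) chart \<Rightarrow> ('m \<Rightarrow> real^'n) \<Rightarrow> 'm \<Rightarrow> real^'n^'n" where
  "nabla_covector w g \<phi> \<mu> p = (\<chi> a b. partial \<phi> a (\<lambda>q. \<mu> q $ b) p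
     - (\<Sum>c\<in>UNIV. christoffel g \<phi> p c a b * \<mu> p $ c) + density_form w g \<phi> p $ a * \<mu> p $ b)"

definition ricci :: "('m, 'n::finite) form_field \<Rightarrow> ('m, 'n) chart \<Rightarrow> 'm \<Rightarrow> real^'n^'n" where
  "ricci g \<phi> p = (\<chi> b d.
     (\<Sum>a\<in>UNIV. partial \<phi> a (\<lambda>q. christoffel g \<phi> q a b d) p)
     - (\<Sum>a\<in>UNIV. partial \<phi> b (\<lambda>q. christoffel g \<phi> q a a d) p)
     + (\<Sum>a\<in>UNIV. \<Sum>e\<in>UNIV. christoffel g \<phi> p a a e * christoffel g \<phi> p e b d)
     - (\<Sum>a\<in>UNIV. \<Sum>e\<in>UNIV. christoffel g \<phi> p a b e * christoffel g \<phi> p e a d))"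

text \<open>\<open>G\<^sup>a\<^sup>b h\<^sub>a\<^sub>b\<close>\<close>

definition g_trace ::
  "('m, 'n::finite) form_field \<Rightarrow> ('m, 'n) chart \<Rightarrow> 'm \<Rightarrow> real^'n^'n \<Rightarrow> real" where
  "g_trace G \<phi> p h = (\<Sum>a\<in>UNIV. \<Sum>b\<in>UNIV. matrix_inv (G \<phi> p) $ a $ b * h $ a $ b)"

text \<open>
  Tracing \<open>P\<^sub>a\<^sub>b = (Ric\<^sub>a\<^sub>b - J G\<^sub>a\<^sub>b) / (n-2)\<close> with \<open>J = G\<^sup>a\<^sup>b P\<^sub>a\<^sub>b\<close> gives the explicit formula for \<open>J\<close>.
\<close>

definition schouten_trace ::
  "('m, 'n::finite) form_field \<Rightarrow> ('m, 'n) form_field \<Rightarrow> ('m, 'n) chart \<Rightarrow> 'm \<Rightarrow> real" where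
  "schouten_trace G g \<phi> p = g_trace G \<phi> p (ricci g \<phi> p) / (2 * (real CARD('n) - 1))"

definition schouten ::
  "('m, 'n::finite) form_field \<Rightarrow> ('m, 'n) form_field \<Rightarrow> ('m, 'n) chart \<Rightarrow> 'm \<Rightarrow> real^'n^'n" where
  "schouten G g \<phi> p = inverse (real CARD('n) - 2) *\<^sub>R
     (ricci g \<phi> p - schouten_trace G g \<phi> p *\<^sub>R G \<phi> p)"

lemma schouten_trace_eq:
  fixes G :: "('m, 'n::finite) form_field"
  assumes "CARD('n) \<ge> 3" "invertible (G \<phi> p)" "transpose (G \<phi> p) = G \<phi> p"
  shows "g_trace G \<phi> p (schouten G g \<phi> p) = schouten_trace G g \<phi> p"
proof -
  let ?n = "real CARD('n)" and ?J = "schouten_trace G g \<phi> p"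
  have sym: "G \<phi> p $ a $ b = G \<phi> p $ b $ a" for a b
  proof -
    have "transpose (G \<phi> p) $ a $ b = G \<phi> p $ b $ a"
      by (simp add: transpose_def)
    then show ?thesis
      unfolding assms(3) .
  qed
  have n: "?n - 2 \<noteq> 0" "2 * (?n - 1) \<noteq> 0"
    using assms(1) by auto
  have "matrix_inv (G \<phi> p) ** G \<phi> p = mat 1"
    using assms(2) unfolding invertible_def matrix_inv_def by (rule someI2_ex) blast
  then have minv: "(\<Sum>b\<in>UNIV. matrix_inv (G \<phi> p) $ a $ b * G \<phi> p $ b $ a) = 1" for a
    unfolding matrix_matrix_mult_def mat_def vec_eq_iff by simp
  have "g_trace G \<phi> p (G \<phi> p) = (\<Sum>a\<in>(UNIV :: 'n set). 1)"
    unfolding g_trace_def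
  proof (rule sum.cong[OF refl])
    fix a :: 'n
    have "(\<Sum>b\<in>UNIV. matrix_inv (G \<phi> p) $ a $ b * G \<phi> p $ a $ b) =
        (\<Sum>b\<in>UNIV. matrix_inv (G \<phi> p) $ a $ b * G \<phi> p $ b $ a)"
      by (rule sum.cong[OF refl]) (subst sym, rule refl)
    also have "\<dots> = 1"
      by (rule minv)
    finally show "(\<Sum>b\<in>UNIV. matrix_inv (G \<phi> p) $ a $ b * G \<phi> p $ a $ b) = 1" .
  qed
  then have trG: "g_trace G \<phi> p (G \<phi> p) = ?n"
    by simp
  have lin: "g_trace G \<phi> p (x *\<^sub>R (A - y *\<^sub>R B)) = x * (g_trace G \<phi> p A - y * g_trace G \<phi> p B)"
    for x y A B
  proof -
    have "g_trace G \<phi> p (x *\<^sub>R (A - y *\<^sub>R B)) = (\<Sum>a\<in>UNIV. \<Sum>b\<in>UNIV.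
        x * (matrix_inv (G \<phi> p) $ a $ b * A $ a $ b - y * (matrix_inv (G \<phi> p) $ a $ b * B $ a $ b)))"
      unfolding g_trace_def by (intro sum.cong refl) (simp add: algebra_simps)
    also have "\<dots> = x * (g_trace G \<phi> p A - y * g_trace G \<phi> p B)"
      unfolding g_trace_def by (simp only: sum_distrib_left[symmetric] sum_subtractf)
    finally show ?thesis .
  qed
  have "g_trace G \<phi> p (schouten G g \<phi> p) =
      inverse (?n - 2) * (g_trace G \<phi> p (ricci g \<phi> p) - ?J * ?n)"
    unfolding schouten_def lin trG by simp
  also have "g_trace G \<phi> p (ricci g \<phi> p) = 2 * (?n - 1) * ?J"
    unfolding schouten_trace_def by (simp only: times_divide_eq_right nonzero_mult_div_cancel_left[OF n(2)])
  also have "2 * (?n - 1) * ?J - ?J * ?n = (?n - 2) * ?J"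
    by (simp only: algebra_simps)
  also have "inverse (?n - 2) * ((?n - 2) * ?J) = ?J"
    by (simp only: mult.assoc[symmetric] left_inverse[OF n(1)] mult_1)
  finally show ?thesis .
qed

section \<open>Tractors\<close>

text \<open>
  In a chart and a scale \<open>g \<in> c\<close>, a standard tractor is a triple \<open>(\<sigma>, \<mu>\<^sub>a, \<rho>)\<close>. A family of such
  triples, indexed by the charts around \<open>p\<close> and the metrics in \<open>c\<close>, is an element of the fibre of
  \<open>\<T>[w]\<close> at \<open>p\<close> if it obeys the following transformation laws.
\<close>

type_synonym 'n triple = "real \<times> (real^'n) \<times> real"

definition tractor_at ::
  "('m, 'n::finite) chart set \<Rightarrow> ('m, 'n) form_field set \<Rightarrow> ('m, 'n) form_field \<Rightarrow> real \<Rightarrow> 'm \<Rightarrow>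
   (('m, 'n) chart \<Rightarrow> ('m, 'n) form_field \<Rightarrow> 'n triple) \<Rightarrow> bool" where
  "tractor_at \<A> c G w p V \<longleftrightarrow>
     (\<forall>\<phi>\<in>\<A>. \<forall>\<psi>\<in>\<A>. \<forall>g\<in>c. p \<in> chart_dom \<phi> \<inter> chart_dom \<psi> \<longrightarrow>
        (case (V \<phi> g, V \<psi> g) of ((\<sigma>, \<mu>, \<rho>), (\<sigma>', \<mu>', \<rho>')) \<Rightarrow>
           \<sigma>' = weight_factor (w + 1) \<phi> \<psi> p * \<sigma> \<and>
           transpose (jac \<phi> \<psi> p) *v \<mu>' = weight_factor (w + 1) \<phi> \<psi> p *\<^sub>R \<mu> \<and>
           \<rho>' = weight_factor (w - 1) \<phi> \<psi> p * \<rho>)) \<and>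
     (\<forall>\<phi>\<in>\<A>. \<forall>g\<in>c. \<forall>h\<in>c. \<forall>\<omega>. p \<in> chart_dom \<phi> \<and> conformal_change \<A> \<omega> g h \<longrightarrow>
        (case (V \<phi> g, V \<phi> h) of ((\<sigma>, \<mu>, \<rho>), (\<sigma>', \<mu>', \<rho>')) \<Rightarrow>
           let \<Upsilon> = (\<chi> a. partial \<phi> a \<omega> p); \<Upsilon>_up = matrix_inv (G \<phi> p) *v \<Upsilon> in
           \<sigma>' = \<sigma> \<and> \<mu>' = \<mu> + \<sigma> *\<^sub>R \<Upsilon> \<and> \<rho>' = \<rho> - \<Upsilon>_up \<bullet> \<mu> - 1/2 * (\<Upsilon>_up \<bullet> \<Upsilon>) * \<sigma>))"

text \<open>
  Indices of the frame \<open>Y, Z\<^sub>a, X\<close> of \<open>\<T>\<close> given by a chart and a scale;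
  \<open>V = \<sigma> Y + \<mu>\<^sup>a Z\<^sub>a + \<rho> X\<close> with \<open>\<mu>\<^sup>a = G\<^sup>a\<^sup>b \<mu>\<^sub>b\<close>.
\<close>

datatype 'n tractor_index = IY | IZ 'n | IX

definition tractor_comp ::
  "('m, 'n::finite) form_field \<Rightarrow> ('m, 'n) chart \<Rightarrow> 'm \<Rightarrow> 'n triple \<Rightarrow> 'n tractor_index \<Rightarrow> real" where
  "tractor_comp G \<phi> p V i = (case V of (\<sigma>, \<mu>, \<rho>) \<Rightarrow>
     (case i of IY \<Rightarrow> \<sigma> | IZ a \<Rightarrow> (matrix_inv (G \<phi> p) *v \<mu>) $ a | IX \<Rightarrow> \<rho>))"

text \<open>
  A contravariant \<open>k\<close>-tensor is represented by its components \<open>T J\<close>, where \<open>J 0, \<dots>, J (k-1)\<close> are the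
  indices; \<open>antisym k\<close> is the projection onto the totally antisymmetric part.
\<close>

definition antisym :: "nat \<Rightarrow> ((nat \<Rightarrow> 'i) \<Rightarrow> real) \<Rightarrow> (nat \<Rightarrow> 'i) \<Rightarrow> real" where
  "antisym k T J = (\<Sum>\<pi> | \<pi> permutes {..<k}. of_int (sign \<pi>) * T (J \<circ> \<pi>)) / fact k"

definition scale_tractor ::
  "('m, 'n::finite) form_field \<Rightarrow> ('m, 'n) scalar_field \<Rightarrow> ('m, 'n) chart \<Rightarrow> ('m, 'n) form_field \<Rightarrow>
   'm \<Rightarrow> 'n triple" where
  "scale_tractor G \<sigma> \<phi> g p =
     (\<sigma> \<phi> p, nabla_density 1 g \<phi> (\<sigma> \<phi>) p,
      - (g_trace G \<phi> p (nabla_covector 1 g \<phi> (nabla_density 1 g \<phi> (\<sigma> \<phi>)) p)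
         + schouten_trace G g \<phi> p * \<sigma> \<phi> p) / real CARD('n))"

definition X_tractor :: "('m, 'n::finite) chart \<Rightarrow> ('m, 'n) form_field \<Rightarrow> 'n triple" where
  "X_tractor \<phi> g = (0, 0, 1)"

lemma X_tractor_at:
  assumes "smooth_manifold \<A>"
  shows "tractor_at \<A> c G 1 p X_tractor"
  unfolding tractor_at_def X_tractor_def weight_factor_def
  using det_jac_nonzero[OF assms] by (auto simp: Let_def)

lemma tractor_at_zero:
  assumes "smooth_manifold \<A>" "tractor_at \<A> (conformal_class \<A> g) G w p V"
    and "\<phi> \<in> \<A>" "\<psi> \<in> \<A>" "p \<in> chart_dom \<phi> \<inter> chart_dom \<psi>"
    and "h \<in> conformal_class \<A> g" "h' \<in> conformal_class \<A> g"
    and "V \<phi> h = 0"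
  shows "V \<psi> h' = 0"
proof -
  obtain \<omega> \<omega>' where \<omega>: "conformal_change \<A> \<omega> g h" "conformal_change \<A> \<omega>' g h'"
    using assms(6,7) by (auto simp: conformal_class_def)
  have "smooth_in \<eta> (\<lambda>q. \<omega>' q - \<omega> q)" if "\<eta> \<in> \<A>" for \<eta>
    unfolding smooth_in_def smooth_on_def o_def
  proof (intro allI Ck_on_diff)
    show "open (coord \<eta> ` chart_dom \<eta>)"
      using assms(1) that unfolding smooth_manifold_def by blast
    show "Ck_on k (coord \<eta> ` chart_dom \<eta>) (\<lambda>x. \<omega>' (coord_inv \<eta> x))"
      and "Ck_on k (coord \<eta> ` chart_dom \<eta>) (\<lambda>x. \<omega> (coord_inv \<eta> x))" for k
      using \<omega> that unfolding conformal_change_def smooth_in_def smooth_on_def o_def by blast+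
  qed
  moreover have "h' \<eta> q = exp (2 * (\<omega>' q - \<omega> q)) *\<^sub>R h \<eta> q" if "\<eta> \<in> \<A>" "q \<in> chart_dom \<eta>" for \<eta> q
  proof -
    have "exp (2 * (\<omega>' q - \<omega> q)) * exp (2 * \<omega> q) = exp (2 * \<omega>' q)"
      by (simp add: exp_add[symmetric] algebra_simps)
    then show ?thesis
      using \<omega> that by (simp add: conformal_change_def)
  qed
  ultimately have "conformal_change \<A> (\<lambda>q. \<omega>' q - \<omega> q) h h'"
    by (simp add: conformal_change_def)
  note cc = this
  obtain \<sigma>1 \<mu>1 \<rho>1 where V1: "V \<phi> h' = (\<sigma>1, \<mu>1, \<rho>1)"
    by (cases "V \<phi> h'") auto
  have V0: "V \<phi> h = (0, 0, 0)"
    using assms(8) by (simp add: zero_prod_def)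
  have "case (V \<phi> h, V \<phi> h') of ((\<sigma>, \<mu>, \<rho>), (\<sigma>', \<mu>', \<rho>')) \<Rightarrow>
      let \<Upsilon> = (\<chi> a. partial \<phi> a (\<lambda>q. \<omega>' q - \<omega> q) p); \<Upsilon>_up = matrix_inv (G \<phi> p) *v \<Upsilon> in
        \<sigma>' = \<sigma> \<and> \<mu>' = \<mu> + \<sigma> *\<^sub>R \<Upsilon> \<and> \<rho>' = \<rho> - \<Upsilon>_up \<bullet> \<mu> - 1/2 * (\<Upsilon>_up \<bullet> \<Upsilon>) * \<sigma>"
    using assms(2)[unfolded tractor_at_def, THEN conjunct2, THEN bspec, OF assms(3), THEN bspec,
        OF assms(6), THEN bspec, OF assms(7), THEN spec, THEN mp, OF conjI[OF IntD1[OF assms(5)] cc]] .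
  then have z: "\<sigma>1 = 0" "\<mu>1 = 0" "\<rho>1 = 0"
    unfolding V0 V1 Let_def by simp_all
  obtain \<sigma> \<mu> \<rho> where V: "V \<psi> h' = (\<sigma>, \<mu>, \<rho>)"
    by (cases "V \<psi> h'") auto
  have "case (V \<phi> h', V \<psi> h') of ((\<sigma>, \<mu>, \<rho>), (\<sigma>', \<mu>', \<rho>')) \<Rightarrow>
      \<sigma>' = weight_factor (w + 1) \<phi> \<psi> p * \<sigma> \<and>
      transpose (jac \<phi> \<psi> p) *v \<mu>' = weight_factor (w + 1) \<phi> \<psi> p *\<^sub>R \<mu> \<and>
      \<rho>' = weight_factor (w - 1) \<phi> \<psi> p * \<rho>"
    using assms(2)[unfolded tractor_at_def, THEN conjunct1, THEN bspec, OF assms(3), THEN bspec,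
        OF assms(4), THEN bspec, OF assms(7), THEN mp, OF assms(5)] .
  then have "\<sigma> = 0" "\<rho> = 0" and \<mu>: "transpose (jac \<phi> \<psi> p) *v \<mu> = 0"
    unfolding V V1 z by simp_all
  have "transpose (jac \<psi> \<phi> p) ** transpose (jac \<phi> \<psi> p) = mat 1"
    using jac_inverse[OF assms(1,3,4,5)] by (metis matrix_transpose_mul transpose_mat)
  then have "\<mu> = 0"
    using \<mu> by (metis matrix_vector_mul_assoc matrix_vector_mul_lid matrix_vector_mult_0_right)
  then show ?thesis
    using V \<open>\<sigma> = 0\<close> \<open>\<rho> = 0\<close> by (simp add: zero_prod_def)
qed

section \<open>Curves\<close>

definition velocity ::
  "real set \<Rightarrow> (real \<Rightarrow> 'm) \<Rightarrow> ('m, 'n::finite) chart \<Rightarrow> real \<Rightarrow> real^'n" where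
  "velocity S \<gamma> \<phi> t = vector_derivative (coord \<phi> \<circ> \<gamma>) (at t within S)"

definition smooth_regular_curve ::
  "('m::{second_countable_topology,t2_space}, 'n::finite) chart set \<Rightarrow> real set \<Rightarrow> (real \<Rightarrow> 'm) \<Rightarrow> bool"
  where
  "smooth_regular_curve \<A> S \<gamma> \<longleftrightarrow>
     is_interval S \<and> interior S \<noteq> {} \<and> \<gamma> ` S \<subseteq> carrier \<A> \<and> continuous_on S \<gamma> \<and>
     (\<forall>\<phi>\<in>\<A>. smooth_on {t \<in> S. \<gamma> t \<in> chart_dom \<phi>} (coord \<phi> \<circ> \<gamma>) \<and>
        (\<forall>t\<in>S. \<gamma> t \<in> chart_dom \<phi> \<longrightarrow> velocity S \<gamma> \<phi> t \<noteq> 0))"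

text \<open>\<open>G\<^sub>a\<^sub>b u\<^sup>a u\<^sup>b\<close>, of weight 2\<close>

definition speed_sq ::
  "('m, 'n::finite) form_field \<Rightarrow> real set \<Rightarrow> (real \<Rightarrow> 'm) \<Rightarrow> ('m, 'n) chart \<Rightarrow> real \<Rightarrow> real" where
  "speed_sq G S \<gamma> \<phi> t = velocity S \<gamma> \<phi> t \<bullet> (G \<phi> (\<gamma> t) *v velocity S \<gamma> \<phi> t)"

definition nowhere_null ::
  "('m, 'n::finite) chart set \<Rightarrow> ('m, 'n) form_field \<Rightarrow> real set \<Rightarrow> (real \<Rightarrow> 'm) \<Rightarrow> bool" where
  "nowhere_null \<A> G S \<gamma> \<longleftrightarrow>
     (\<forall>t\<in>S. \<forall>\<phi>\<in>\<A>. \<gamma> t \<in> chart_dom \<phi> \<longrightarrow> speed_sq G S \<gamma> \<phi> t \<noteq> 0)"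

text \<open>The component in the chart \<open>\<phi>\<close> of the density \<open>\<sigma>\<^sub>u\<close> of weight 1 along the curve.\<close>

definition speed ::
  "('m, 'n::finite) form_field \<Rightarrow> real set \<Rightarrow> (real \<Rightarrow> 'm) \<Rightarrow> ('m, 'n) chart \<Rightarrow> real \<Rightarrow> real" where
  "speed G S \<gamma> \<phi> t = sqrt \<bar>speed_sq G S \<gamma> \<phi> t\<bar>"

text \<open>\<open>u\<^sup>a \<nabla>\<^sub>a u\<^sup>b\<close>\<close>

definition acceleration ::
  "('m, 'n::finite) form_field \<Rightarrow> real set \<Rightarrow> (real \<Rightarrow> 'm) \<Rightarrow> ('m, 'n) chart \<Rightarrow> real \<Rightarrow> real^'n" where
  "acceleration g S \<gamma> \<phi> t = (let u = velocity S \<gamma> \<phi> in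
     vector_derivative u (at t within S) +
     (\<chi> b. \<Sum>a\<in>UNIV. \<Sum>c\<in>UNIV. christoffel g \<phi> (\<gamma> t) b a c * u t $ a * u t $ c))"

definition unparametrised_geodesic ::
  "('m, 'n::finite) chart set \<Rightarrow> ('m, 'n) form_field \<Rightarrow> real set \<Rightarrow> (real \<Rightarrow> 'm) \<Rightarrow> bool" where
  "unparametrised_geodesic \<A> g S \<gamma> \<longleftrightarrow>
     (\<forall>t\<in>S. \<exists>k. \<forall>\<phi>\<in>\<A>. \<gamma> t \<in> chart_dom \<phi> \<longrightarrow>
        acceleration g S \<gamma> \<phi> t = k *\<^sub>R velocity S \<gamma> \<phi> t)"

text \<open>
  \<open>u\<^sup>a \<nabla>\<^sub>a V\<close> for a section \<open>V = (\<sigma>, \<mu>\<^sub>a, \<rho>)\<close> of \<open>\<T>\<close> along the curve (with the velocity \<open>u\<close>, not the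
  weighted velocity), for the tractor connection. The components of \<open>V\<close> have weights \<open>1\<close>, \<open>1\<close> and \<open>-1\<close>.
\<close>

definition tractor_deriv ::
  "('m, 'n::finite) form_field \<Rightarrow> real set \<Rightarrow> (real \<Rightarrow> 'm) \<Rightarrow> ('m, 'n) chart \<Rightarrow> ('m, 'n) form_field \<Rightarrow>
   (real \<Rightarrow> 'n triple) \<Rightarrow> real \<Rightarrow> 'n triple" where
  "tractor_deriv G S \<gamma> \<phi> g V t =
     (let u = velocity S \<gamma> \<phi> t; p = \<gamma> t; \<theta> = u \<bullet> density_form 1 g \<phi> p in
      case (V t, vector_derivative V (at t within S)) of ((\<sigma>, \<mu>, \<rho>), (\<sigma>', \<mu>', \<rho>')) \<Rightarrow>
       ((\<sigma>' + \<theta> * \<sigma>) - u \<bullet> \<mu>,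
        (\<mu>' - (\<chi> b. \<Sum>a\<in>UNIV. \<Sum>c\<in>UNIV. christoffel g \<phi> p c a b * u $ a * \<mu> $ c) + \<theta> *\<^sub>R \<mu>)
          + \<rho> *\<^sub>R (G \<phi> p *v u) + \<sigma> *\<^sub>R (u v* schouten G g \<phi> p),
        (\<rho>' - \<theta> * \<rho>) - u \<bullet> (schouten G g \<phi> p *v (matrix_inv (G \<phi> p) *v \<mu>))))"

text \<open>The same derivative for the weighted velocity \<open>\<sigma>\<^sub>u\<^sup>-\<^sup>1 u\<^sup>a\<close>.\<close>

definition weighted_tractor_deriv ::
  "('m, 'n::finite) form_field \<Rightarrow> real set \<Rightarrow> (real \<Rightarrow> 'm) \<Rightarrow> ('m, 'n) chart \<Rightarrow> ('m, 'n) form_field \<Rightarrow>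
   (real \<Rightarrow> 'n triple) \<Rightarrow> real \<Rightarrow> 'n triple" where
  "weighted_tractor_deriv G S \<gamma> \<phi> g V t =
     inverse (speed G S \<gamma> \<phi> t) *\<^sub>R tractor_deriv G S \<gamma> \<phi> g V t"

definition U_tractor ::
  "('m, 'n::finite) form_field \<Rightarrow> real set \<Rightarrow> (real \<Rightarrow> 'm) \<Rightarrow> ('m, 'n) chart \<Rightarrow> ('m, 'n) form_field \<Rightarrow>
   real \<Rightarrow> 'n triple" where
  "U_tractor G S \<gamma> \<phi> g t = speed G S \<gamma> \<phi> t *\<^sub>R
     weighted_tractor_deriv G S \<gamma> \<phi> g (\<lambda>s. inverse (speed G S \<gamma> \<phi> s) *\<^sub>R X_tractor \<phi> g) t"

definition A_tractor ::
  "('m, 'n::finite) form_field \<Rightarrow> real set \<Rightarrow> (real \<Rightarrow> 'm) \<Rightarrow> ('m, 'n) chart \<Rightarrow> ('m, 'n) form_field \<Rightarrow>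
   real \<Rightarrow> 'n triple" where
  "A_tractor G S \<gamma> \<phi> g t = speed G S \<gamma> \<phi> t *\<^sub>R
     weighted_tractor_deriv G S \<gamma> \<phi> g (U_tractor G S \<gamma> \<phi> g) t"

text \<open>\<open>\<Sigma>\<^sup>A\<^sup>B\<^sup>C = 6 \<sigma>\<^sub>u\<^sup>-\<^sup>1 X\<^bsup>[A\<^esup> U\<^sup>B A\<^bsup>C]\<^esup>\<close>\<close>

definition three_tractor ::
  "('m, 'n::finite) form_field \<Rightarrow> real set \<Rightarrow> (real \<Rightarrow> 'm) \<Rightarrow> ('m, 'n) chart \<Rightarrow> ('m, 'n) form_field \<Rightarrow>
   real \<Rightarrow> (nat \<Rightarrow> 'n tractor_index) \<Rightarrow> real" where
  "three_tractor G S \<gamma> \<phi> g t J = 6 * inverse (speed G S \<gamma> \<phi> t) *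
     antisym 3 (\<lambda>K. tractor_comp G \<phi> (\<gamma> t) (X_tractor \<phi> g) (K 0) *
       tractor_comp G \<phi> (\<gamma> t) (U_tractor G S \<gamma> \<phi> g t) (K 1) *
       tractor_comp G \<phi> (\<gamma> t) (A_tractor G S \<gamma> \<phi> g t) (K 2)) J"

text \<open>\<open>I\<^bsup>[A\<^esup> \<Sigma>\<^bsup>BCD]\<^esup>\<close> along the curve, in the chart \<open>\<phi>\<close> and the scale \<open>g\<close>.\<close>

definition I_wedge_Sigma ::
  "('m, 'n::finite) form_field \<Rightarrow> ('m, 'n) scalar_field \<Rightarrow> real set \<Rightarrow> (real \<Rightarrow> 'm) \<Rightarrow>
   ('m, 'n) chart \<Rightarrow> ('m, 'n) form_field \<Rightarrow> real \<Rightarrow> (nat \<Rightarrow> 'n tractor_index) \<Rightarrow> real" where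
  "I_wedge_Sigma G \<sigma> S \<gamma> \<phi> g t =
     antisym 4 (\<lambda>K. tractor_comp G \<phi> (\<gamma> t) (scale_tractor G \<sigma> \<phi> g (\<gamma> t)) (K 0) *
       three_tractor G S \<gamma> \<phi> g t (\<lambda>i. K (Suc i)))"

end

theory Submission
  imports Defs
begin

text \<open>
  In a chart and a scale \<open>h = \<tau>\<^sup>-\<^sup>2 G\<close> of the class, modulo \<open>X\<close>, the tractors \<open>U\<close> and \<open>A\<close> are
  \<open>(0, u / \<sigma>\<^sub>u)\<close> and \<open>(\<mp>\<sigma>\<^sub>u, a)\<close> with \<open>\<sigma>\<^sub>u a\<close> equal to the \<open>h\<close>-acceleration up to multiples of \<open>u\<close>, while \<open>I\<close> is
  \<open>(\<sigma>, d\<sigma> - \<sigma> d\<tau> / \<tau>)\<close>, because \<open>\<bar>det G\<bar> = 1\<close> makes the trace of the connection \<open>- n d\<tau> / \<tau>\<close>. So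
  \<open>I \<and> \<Sigma> = 0\<close> says that a combination of \<open>a\<close> and \<open>d\<sigma> - \<sigma> d\<tau> / \<tau>\<close> is proportional to \<open>u\<close>; the
  \<open>\<tau>\<close>-terms cancel against those in the \<open>h\<close>-acceleration, and what is left is \<open>\<sigma>\<close> times the
  acceleration for \<open>g = \<sigma>\<^sup>-\<^sup>2 G\<close>. In each chart this gives a factor \<open>k\<close> with \<open>u\<^sup>a \<nabla>\<^sub>a u\<^sup>b = k u\<^sup>b\<close>; it is the
  same in all charts since \<open>2k\<close> is the logarithmic derivative of the scalar \<open>g(u, u)\<close>.
\<close>

section \<open>Antisymmetrisation\<close>

lemma antisym_3:
  "antisym 3 T J = (T J - T (J \<circ> Transposition.transpose 0 1) - T (J \<circ> Transposition.transpose 0 2)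
     - T (J \<circ> Transposition.transpose 1 2)
     + T (J \<circ> (Transposition.transpose 0 1 \<circ> Transposition.transpose 1 2))
     + T (J \<circ> (Transposition.transpose 0 2 \<circ> Transposition.transpose 1 2))) / 6"
proof -
  have s: "{..<3::nat} = insert 0 (insert 1 (insert 2 {}))" by auto
  have fin: "finite {1,2::nat}" "0 \<notin> {1,2::nat}" "finite {2::nat}" "1 \<notin> {2::nat}"
    by auto
  show ?thesis
    unfolding antisym_def s sum_over_permutations_insert[OF fin(1,2)] sum_over_permutations_insert[OF fin(3,4)]
    by (simp add: sign_compose permutation_swap_id sign_swap_id fact_numeral)
qed

text \<open>Six times the antisymmetrised product is the 3 by 3 determinant with rows
  \<open>X\<close>, \<open>U\<close>, \<open>A\<close>, expanded along \<open>X\<close>.\<close>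

lemma antisym_prod_3:
  "antisym 3 (\<lambda>K. X (K 0) * U (K 1) * A (K 2)) J =
     (X (J 0) * (U (J 1) * A (J 2) - U (J 2) * A (J 1))
      - X (J 1) * (U (J 0) * A (J 2) - U (J 2) * A (J 0))
      + X (J 2) * (U (J 0) * A (J 1) - U (J 1) * A (J 0))) / 6"
  unfolding antisym_3 by (simp add: algebra_simps Transposition.transpose_def)

text \<open>The 24 permutations split into four groups according to the index received by
  \<open>f\<close>. Alternation of \<open>d\<close> makes the six terms of a group equal, which
  turns 1/24 into 1/4.\<close>

lemma antisym_4_alternating:
  assumes "\<And>x y z. d y x z = - d x y z" "\<And>x y z. d x z y = - d x y z"
  shows "antisym 4 (\<lambda>K. f (K 0) * d (K 1) (K 2) (K 3)) J =
    (f (J 0) * d (J 1) (J 2) (J 3) - f (J 1) * d (J 0) (J 2) (J 3)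
      + f (J 2) * d (J 0) (J 1) (J 3) - f (J 3) * d (J 0) (J 1) (J 2)) / 4"
proof -
  have s: "{..<4::nat} = insert 0 (insert 1 (insert 2 (insert 3 {})))" by auto
  have fin: "finite {1,2,3::nat}" "0 \<notin> {1,2,3::nat}" "finite {2,3::nat}" "1 \<notin> {2,3::nat}"
      "finite {3::nat}" "2 \<notin> {3::nat}" by auto
  have p: "d y x z = - d x y z" "d x z y = - d x y z" "d y z x = d x y z" "d z x y = d x y z"
    "d z y x = - d x y z" for x y z
    using assms by (metis minus_minus)+
  note r = p[where x="J 0" and y="J (Suc 0)" and z="J 2"]
    p[where x="J 0" and y="J (Suc 0)" and z="J 3"]
    p[where x="J 0" and y="J 2" and z="J 3"]
    p[where x="J (Suc 0)" and y="J 2" and z="J 3"]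
  show ?thesis
    unfolding antisym_def s sum_over_permutations_insert[OF fin(1,2)]
      sum_over_permutations_insert[OF fin(3,4)] sum_over_permutations_insert[OF fin(5,6)]
    by (simp add: sign_compose permutation_swap_id permutation_compose sign_swap_id fact_numeral
        Transposition.transpose_def) (simp add: r)
qed

text \<open>The wedge vanishes iff \<open>I\<close> lies in the span of the independent vectors
  \<open>X\<close>, \<open>U\<close>, \<open>A\<close>. As \<open>X\<close> is the last basis
  vector, the \<open>IX\<close> entries of the others are free; removing the \<open>IY\<close> entry
  of \<open>I\<close> by a multiple of \<open>A\<close> leaves a condition on the middle parts
  alone.\<close>

lemma alternating_wedge_zero_iff:
  fixes X U A I :: "'n::finite tractor_index \<Rightarrow> real" and U' A' I' :: "real^'n"
  assumes X: "X IY = 0" "\<And>a. X (IZ a) = 0" "X IX = 1"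
    and U: "U IY = 0" "\<And>a. U (IZ a) = U' $ a" "U' \<noteq> 0"
    and A: "A IY = \<alpha>" "\<And>a. A (IZ a) = A' $ a" "\<alpha> \<noteq> 0"
    and I: "I IY = \<sigma>" "\<And>a. I (IZ a) = I' $ a"
    and "r \<noteq> 0"
  shows "(\<forall>J. antisym 4 (\<lambda>K. I (K 0) *
      (r * antisym 3 (\<lambda>K. X (K 0) * U (K 1) * A (K 2)) (\<lambda>i. K (Suc i)))) J = 0) \<longleftrightarrow>
    (\<exists>k. \<sigma> *\<^sub>R A' - \<alpha> *\<^sub>R I' = k *\<^sub>R U')"
proof -
  \<comment> \<open>The threefold product as an explicit alternating function, the form that
    \<open>antisym_4_alternating\<close> expects.\<close>
  define d where "d x y z = r / 6 * (X x * (U y * A z - U z * A y) - X y * (U x * A z - U z * A x)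
      + X z * (U x * A y - U y * A x))" for x y z
  have "antisym 4 (\<lambda>K. I (K 0) * (r * antisym 3 (\<lambda>K. X (K 0) * U (K 1) * A (K 2)) (\<lambda>i. K (Suc i)))) J =
      antisym 4 (\<lambda>K. I (K 0) * d (K 1) (K 2) (K 3)) J" for J
    unfolding antisym_prod_3 d_def by (simp add: numeral_2_eq_2 numeral_3_eq_3)
  also have "\<dots> J = (I (J 0) * d (J 1) (J 2) (J 3) - I (J 1) * d (J 0) (J 2) (J 3)
      + I (J 2) * d (J 0) (J 1) (J 3) - I (J 3) * d (J 0) (J 1) (J 2)) / 4" for J
    by (rule antisym_4_alternating) (simp_all add: d_def algebra_simps)
  finally have W: "antisym 4 (\<lambda>K. I (K 0) *
      (r * antisym 3 (\<lambda>K. X (K 0) * U (K 1) * A (K 2)) (\<lambda>i. K (Suc i)))) J =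
      (I (J 0) * d (J 1) (J 2) (J 3) - I (J 1) * d (J 0) (J 2) (J 3)
      + I (J 2) * d (J 0) (J 1) (J 3) - I (J 3) * d (J 0) (J 1) (J 2)) / 4" for J .
  show ?thesis
    unfolding W
  proof
    assume 0: "\<forall>J :: nat \<Rightarrow> 'n tractor_index. (I (J 0) * d (J 1) (J 2) (J 3) - I (J 1) * d (J 0) (J 2) (J 3)
      + I (J 2) * d (J 0) (J 1) (J 3) - I (J 3) * d (J 0) (J 1) (J 2)) / 4 = 0"
    let ?V = "\<sigma> *\<^sub>R A' - \<alpha> *\<^sub>R I'"
    have V: "U' $ b * ?V $ c = U' $ c * ?V $ b" for b c
    proof -
      \<comment> \<open>Since \<open>X\<close> has only its \<open>IX\<close> entry and
        \<open>U\<close> has no \<open>IY\<close> entry, this component of the wedge is a nonzero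
        multiple of the 2 by 2 minor of \<open>U'\<close> and \<open>?V\<close> in columns
        \<open>b\<close> and \<open>c\<close>.\<close>
      let ?J = "(!) [IX, IY, IZ b, IZ c]"
      have "r * (U' $ b * ?V $ c - U' $ c * ?V $ b) = 0"
        using 0[rule_format, of ?J] by (simp add: d_def X U A I numeral_2_eq_2 numeral_3_eq_3 algebra_simps)
      then show ?thesis
        using \<open>r \<noteq> 0\<close> by simp
    qed
    obtain b where b: "U' $ b \<noteq> 0"
      using U(3) by (metis vec_eq_iff zero_index)
    have "?V = (?V $ b / U' $ b) *\<^sub>R U'"
      unfolding vec_eq_iff
    proof
      fix c
      show "?V $ c = ((?V $ b / U' $ b) *\<^sub>R U') $ c"
        using V[of b c] b by (simp add: field_simps)
    qed
    then show "\<exists>k. ?V = k *\<^sub>R U'" ..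
  next
    assume "\<exists>k. \<sigma> *\<^sub>R A' - \<alpha> *\<^sub>R I' = k *\<^sub>R U'"
    then obtain k where k: "\<sigma> * A' $ a - \<alpha> * I' $ a = k * U' $ a" for a
      by (auto simp: vec_eq_iff)
    \<comment> \<open>The coefficient of \<open>X\<close> is chosen to match the \<open>IX\<close>
      entries; the coefficients of \<open>A\<close> and \<open>U\<close> are forced by the other
      entries.\<close>
    define x where "x = I IX - \<sigma> / \<alpha> * A IX + k / \<alpha> * U IX"
    have "I i = \<sigma> / \<alpha> * A i + - (k / \<alpha>) * U i + x * X i" for i
    proof (cases i)
      case (IZ a)
      then show ?thesis
        using k[of a] A(3) by (simp add: X U A I field_simps)
    qed (use A(3) in \<open>simp_all add: X U A I x_def\<close>)
    then obtain y z where I': "\<And>i. I i = y * A i + z * U i + x * X i"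
      by blast
    define e where "e a b c = X a * (U b * A c - U c * A b) - X b * (U a * A c - U c * A a)
      + X c * (U a * A b - U b * A a)" for a b c
    \<comment> \<open>This is a 4 by 4 determinant whose first row is a linear combination of the
      other three.\<close>
    have "I a * e b c d' - I b * e a c d' + I c * e a b d' - I d' * e a b c = 0" for a b c d'
      unfolding I' e_def by (simp add: algebra_simps)
    moreover have de: "d a b c = r / 6 * e a b c" for a b c
      by (simp add: d_def e_def)
    have "I a * d b c d' - I b * d a c d' + I c * d a b d' - I d' * d a b c =
      r / 6 * (I a * e b c d' - I b * e a c d' + I c * e a b d' - I d' * e a b c)" for a b c d'
      unfolding de by (simp add: algebra_simps)
    ultimately show "\<forall>J :: nat \<Rightarrow> 'n tractor_index. (I (J 0) * d (J 1) (J 2) (J 3) - I (J 1) * d (J 0) (J 2) (J 3)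
      + I (J 2) * d (J 0) (J 1) (J 3) - I (J 3) * d (J 0) (J 1) (J 2)) / 4 = 0"
      by simp
  qed
qed

section \<open>Calculus in charts\<close>

lemma has_vector_derivative_vec_iff:
  fixes f :: "real \<Rightarrow> real^'n"
  shows "(f has_vector_derivative f') (at t within S) \<longleftrightarrow>
    (\<forall>i. ((\<lambda>s. f s $ i) has_real_derivative f' $ i) (at t within S))"
  unfolding has_vector_derivative_def has_derivative_componentwise_within[of f]
    has_real_derivative_iff_has_vector_derivative
  by (auto simp: Basis_vec_def inner_axis)

text \<open>Writing \<open>\<bar>q\<bar>\<close> as the square root of the square of
  \<open>q\<close> treats both signs at once, so that spacelike and timelike curves need no separate
  cases.\<close>

lemma has_real_derivative_inverse_sqrt_abs:
  assumes "(q has_real_derivative q') (at t within S)" "q t \<noteq> 0"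
  shows "((\<lambda>s. inverse (sqrt \<bar>q s\<bar>)) has_real_derivative
    - (inverse (sqrt \<bar>q t\<bar>) * q' / (2 * q t))) (at t within S)"
proof -
  have "((\<lambda>s. (q s)\<^sup>2) has_real_derivative 2 * q t * q') (at t within S)"
    using DERIV_power[OF assms(1), of 2] by (simp add: mult_ac)
  then have "((\<lambda>s. sqrt ((q s)\<^sup>2)) has_real_derivative
      inverse (sqrt ((q t)\<^sup>2)) / 2 * (2 * q t * q')) (at t within S)"
    by (rule DERIV_chain2[OF DERIV_real_sqrt, rotated]) (use assms(2) in simp)
  then have "((\<lambda>s. \<bar>q s\<bar>) has_real_derivative q t / \<bar>q t\<bar> * q') (at t within S)"
    by (simp add: field_simps)
  then have "((\<lambda>s. sqrt \<bar>q s\<bar>) has_real_derivative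
      inverse (sqrt \<bar>q t\<bar>) / 2 * (q t / \<bar>q t\<bar> * q')) (at t within S)"
    by (rule DERIV_chain2[OF DERIV_real_sqrt, rotated]) (use assms(2) in simp)
  then have "((\<lambda>s. inverse (sqrt \<bar>q s\<bar>)) has_real_derivative
      - (inverse (sqrt \<bar>q t\<bar>) * (inverse (sqrt \<bar>q t\<bar>) / 2 * (q t / \<bar>q t\<bar> * q')) *
        inverse (sqrt \<bar>q t\<bar>))) (at t within S)"
    by (rule DERIV_inverse') (use assms(2) in simp)
  moreover have "inverse (sqrt \<bar>q t\<bar>) * (inverse (sqrt \<bar>q t\<bar>) / 2 * (q t / \<bar>q t\<bar> * q')) *
      inverse (sqrt \<bar>q t\<bar>) = inverse (sqrt \<bar>q t\<bar>) * q' / (2 * q t)"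
  proof -
    have r: "inverse (sqrt \<bar>q t\<bar>) * inverse (sqrt \<bar>q t\<bar>) * (q t / \<bar>q t\<bar>) = inverse (q t)"
      using assms(2) by (cases "q t > 0") (simp_all add: inverse_mult_distrib[symmetric] field_simps)
    have c: "r * (r / 2 * (w * q')) * r = r * (r * r * w) * q' / 2" for r w
      by (simp add: algebra_simps)
    show ?thesis
      unfolding c r by (simp add: field_simps)
  qed
  ultimately show ?thesis
    by (simp only:)
qed

text \<open>Jacobi's formula at the identity, where only the identity permutation contributes to the
  derivative.\<close>

lemma has_derivative_det_mat_1:
  fixes B :: "'a::real_normed_vector \<Rightarrow> real^'n^'n"
  assumes "\<And>i j. ((\<lambda>x. B x $ i $ j) has_derivative (\<lambda>v. D v $ i $ j)) (at x)" "B x = mat 1"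
  shows "((\<lambda>x. det (B x)) has_derivative (\<lambda>v. trace (D v))) (at x)"
proof -
  \<comment> \<open>A permutation other than the identity moves at least two points, so a vanishing
    off-diagonal entry remains after the factor at \<open>i\<close> is removed.\<close>
  have p: "(\<Prod>j\<in>UNIV - {i}. (mat 1 :: real^'n^'n) $ j $ \<pi> j) = (if \<pi> = id then 1 else 0)"
    if "\<pi> permutes UNIV" for \<pi> and i :: 'n
  proof (cases "\<pi> = id")
    case False
    then obtain j where j: "\<pi> j \<noteq> j" by (auto simp: fun_eq_iff)
    then have "\<pi> (\<pi> j) \<noteq> \<pi> j" using that by (metis permutes_inverses(2))
    then obtain k where "k \<noteq> i" "\<pi> k \<noteq> k" using j by metis
    then have "\<exists>k\<in>UNIV-{i}. (mat 1 :: real^'n^'n) $ k $ \<pi> k = 0"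
      by (intro bexI[of _ k]) (auto simp: mat_def)
    then show ?thesis using False by simp
  qed (simp add: mat_def)
  have "((\<lambda>x. det (B x)) has_derivative (\<lambda>v. \<Sum>\<pi> | \<pi> permutes UNIV. of_int (sign \<pi>) *
      (\<Sum>i\<in>UNIV. D v $ i $ \<pi> i * (\<Prod>j\<in>UNIV - {i}. B x $ j $ \<pi> j)))) (at x)"
    unfolding det_def by (rule derivative_intros assms)+
  also have "(\<lambda>v. \<Sum>\<pi> | \<pi> permutes UNIV. of_int (sign \<pi>) *
      (\<Sum>i\<in>UNIV. D v $ i $ \<pi> i * (\<Prod>j\<in>UNIV - {i}. B x $ j $ \<pi> j))) = 
     (\<lambda>v. \<Sum>\<pi> | \<pi> permutes (UNIV::'n set). if \<pi> = id then trace (D v) else 0)"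
    unfolding assms(2) by (intro ext sum.cong refl) (auto simp: p trace_def)
  also have "\<dots> = (\<lambda>v. trace (D v))"
    by (simp add: sum.delta finite_permutations permutes_id)
  finally show ?thesis .
qed

section \<open>Smoothness within sets that need not be open\<close>

lemma frechet_derivative_cong_within:
  assumes "x \<in> S" "\<And>x. x \<in> S \<Longrightarrow> f x = g x"
  shows "frechet_derivative f (at x within S) = frechet_derivative g (at x within S)"
    and "f differentiable (at x within S) \<longleftrightarrow> g differentiable (at x within S)"
proof -
  have "(f has_derivative D) (at x within S) \<longleftrightarrow> (g has_derivative D) (at x within S)" for D
    using has_derivative_transform[OF assms(1), of f g] has_derivative_transform[OF assms(1), of g f] assms(2)
    by metis
  then show "frechet_derivative f (at x within S) = frechet_derivative g (at x within S)"
    and "f differentiable (at x within S) \<longleftrightarrow> g differentiable (at x within S)"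
    by (auto simp: frechet_derivative_def differentiable_def)
qed

text \<open>For curves, \<open>S\<close> is a relatively open part of an interval and may contain an
  endpoint, so openness cannot be assumed. Functions that agree on all of \<open>S\<close> have the
  same derivatives within \<open>S\<close>, hence the same chosen one.\<close>

lemma Ck_on_cong_within:
  assumes "\<And>x. x \<in> S \<Longrightarrow> f x = g x" "Ck_on k S f"
  shows "Ck_on k S g"
  using assms
proof (induction k arbitrary: f g)
  case 0
  then show ?case by (simp cong: continuous_on_cong)
next
  case (Suc k)
  have "g differentiable_on S"
    using Suc.prems frechet_derivative_cong_within(2)[of _ S f g] by (auto simp: differentiable_on_def)
  moreover have "Ck_on k S (\<lambda>x. frechet_derivative g (at x within S) v)" for v
    by (rule Suc.IH[of "\<lambda>x. frechet_derivative f (at x within S) v"])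
      (use Suc.prems frechet_derivative_cong_within(1)[of _ S f g] in auto)
  ultimately show ?case by simp
qed

lemma smooth_on_cong:
  assumes "\<And>x. x \<in> S \<Longrightarrow> f x = g x" "smooth_on S f"
  shows "smooth_on S g"
  using assms Ck_on_cong_within[of S f g] by (auto simp: smooth_on_def)

lemma smooth_on_frechet_derivative:
  assumes "smooth_on S f"
  shows "smooth_on S (\<lambda>x. frechet_derivative f (at x within S) v)"
  unfolding smooth_on_def
proof
  fix k
  have "Ck_on (Suc k) S f"
    using assms unfolding smooth_on_def by blast
  then show "Ck_on k S (\<lambda>x. frechet_derivative f (at x within S) v)"
    by simp
qed

lemma smooth_on_has_derivative:
  assumes "smooth_on S f" "x \<in> S"
  shows "(f has_derivative frechet_derivative f (at x within S)) (at x within S)"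
proof -
  have "Ck_on (Suc 0) S f"
    using assms(1) unfolding smooth_on_def by blast
  then show ?thesis
    using assms(2) by (simp add: differentiable_on_def frechet_derivative_works)
qed

lemma Ck_on_bounded_linear:
  assumes "open S" "bounded_linear L"
  shows "Ck_on k S f \<Longrightarrow> Ck_on k S (\<lambda>x. L (f x))"
proof (induction k arbitrary: f)
  case 0
  then show ?case
    using bounded_linear.continuous_on[OF assms(2)] by simp
next
  case (Suc k)
  note f = Ck_on_SucD[OF assms(1) Suc.prems]
  note hd = bounded_linear.has_derivative[OF assms(2) f(1)]
  show ?case
  proof (rule Ck_on_SucI[OF assms(1) hd])
    fix v
    show "Ck_on k S (\<lambda>x. frechet_derivative (\<lambda>x. L (f x)) (at x within S) v)"
      by (rule Ck_on_cong[OF assms(1) _ Suc.IH[OF f(2)[of v]]])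
        (use assms(1) frechet_derivative_within_open[OF assms(1) _ hd]
          frechet_derivative_within_open[OF assms(1) _ f(1)] in auto)
  qed
qed

text \<open>Nontriviality of the filter excludes isolated points, so the derivative is unique and
  the two chosen derivatives must agree.\<close>

lemma smooth_on_has_vector_derivative:
  assumes "smooth_on S f" "t \<in> S" "at t within S \<noteq> bot"
  shows "(f has_vector_derivative vector_derivative f (at t within S)) (at t within S)"
    and "frechet_derivative f (at t within S) 1 = vector_derivative f (at t within S)"
proof -
  note d = smooth_on_has_derivative[OF assms(1,2)]
  show v: "(f has_vector_derivative vector_derivative f (at t within S)) (at t within S)"
    using d differentiableI vector_derivative_works by blast
  have "(f has_vector_derivative frechet_derivative f (at t within S) 1) (at t within S)"
    unfolding has_vector_derivative_def
    using d linear_scale[OF has_derivative_linear[OF d], of _ 1, symmetric] by (simp add: eta_contract_eq)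
  then show "frechet_derivative f (at t within S) 1 = vector_derivative f (at t within S)"
    using vector_derivative_within[OF assms(3)] by metis
qed

lemma smooth_on_vector_derivative:
  assumes "smooth_on S f" "\<And>t. t \<in> S \<Longrightarrow> at t within S \<noteq> bot"
  shows "smooth_on S (\<lambda>t. vector_derivative f (at t within S))"
  by (rule smooth_on_cong[OF _ smooth_on_frechet_derivative[OF assms(1), of 1]])
    (use smooth_on_has_vector_derivative(2) assms in blast)

section \<open>Fields and partial derivatives in a single chart\<close>

locale manifold_chart =
  fixes \<A> :: "('m::{second_countable_topology,t2_space}, 'n::finite) chart set"
    and \<phi> :: "('m, 'n) chart"
  assumes manifold: "smooth_manifold \<A>" and chart: "\<phi> \<in> \<A>"
begin

lemma open_dom: "open (chart_dom \<phi>)"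
  and open_im: "open (coord \<phi> ` chart_dom \<phi>)"
  and homeo: "homeomorphism (chart_dom \<phi>) (coord \<phi> ` chart_dom \<phi>) (coord \<phi>) (coord_inv \<phi>)"
  using manifold chart unfolding smooth_manifold_def by auto

lemma coord_inv_coord: "p \<in> chart_dom \<phi> \<Longrightarrow> coord_inv \<phi> (coord \<phi> p) = p"
  using homeo by (auto simp: homeomorphism_def)

lemma smooth_in_bounded_linear:
  assumes "smooth_in \<phi> f" "bounded_linear L"
  shows "smooth_in \<phi> (\<lambda>q. L (f q))"
  using Ck_on_bounded_linear[OF open_im assms(2)] assms(1)
  by (simp add: smooth_in_def smooth_on_def o_def)

lemma smooth_in_const: "smooth_in \<phi> (\<lambda>q. c :: 'b::real_normed_vector)"
proof -
  have "Ck_on k (coord \<phi> ` chart_dom \<phi>) (\<lambda>x. c)" for k and c :: 'b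
  proof (induction k arbitrary: c)
    case (Suc k)
    show ?case
      by (rule Ck_on_SucI[OF open_im has_derivative_const])
        (rule Ck_on_cong[OF open_im _ Suc.IH[of 0]],
          simp add: frechet_derivative_within_open[OF open_im _ has_derivative_const])
  qed simp
  then show ?thesis
    by (simp add: smooth_in_def smooth_on_def o_def)
qed

lemma smooth_in_has_derivative:
  fixes f :: "'m \<Rightarrow> real"
  assumes "smooth_in \<phi> f" "p \<in> chart_dom \<phi>"
  shows "(f \<circ> coord_inv \<phi> has_derivative (\<lambda>v. \<Sum>a\<in>UNIV. v $ a * partial \<phi> a f p)) (at (coord \<phi> p))"
proof -
  let ?D = "frechet_derivative (f \<circ> coord_inv \<phi>) (at (coord \<phi> p))"
  have "(f \<circ> coord_inv \<phi>) differentiable (at (coord \<phi> p))"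
    using smooth_on_differentiable[OF _ open_im] assms by (auto simp: smooth_in_def)
  then have D: "(f \<circ> coord_inv \<phi> has_derivative ?D) (at (coord \<phi> p))"
    by (simp add: frechet_derivative_works)
  have lin: "linear ?D"
    using has_derivative_linear[OF D] .
  have "?D v = (\<Sum>a\<in>UNIV. v $ a * partial \<phi> a f p)" for v
  proof -
    have "?D v = ?D (\<Sum>a\<in>UNIV. v $ a *\<^sub>R axis a 1)"
      using basis_expansion[of v] by (simp add: scalar_mult_eq_scaleR)
    then show ?thesis
      by (simp add: linear_sum[OF lin] linear_scale[OF lin] partial_def)
  qed
  then show ?thesis
    using D by presburger
qed

lemma partial_eqI:
  assumes "(f \<circ> coord_inv \<phi> has_derivative D) (at (coord \<phi> p))"
  shows "partial \<phi> a f p = D (axis a 1)"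
  using frechet_derivative_at[OF assms] by (simp add: partial_def)

text \<open>The coordinate image of the chart is open, so the arbitrary values of a field outside
  the chart domain cannot affect its partial derivatives inside.\<close>

lemma partial_cong:
  assumes "smooth_in \<phi> f" "p \<in> chart_dom \<phi>" "\<And>q. q \<in> chart_dom \<phi> \<Longrightarrow> f q = g q"
  shows "partial \<phi> a g p = partial \<phi> a f p"
proof -
  have "(g \<circ> coord_inv \<phi> has_derivative (\<lambda>v. \<Sum>a\<in>UNIV. v $ a * partial \<phi> a f p)) (at (coord \<phi> p))"
    by (rule has_derivative_transform_within_open[OF smooth_in_has_derivative[OF assms(1,2)] open_im])
      (use assms(2,3) coord_inv_coord in auto)
  from partial_eqI[OF this, of a] show ?thesis
    by (simp add: axis_def if_distrib[of "\<lambda>x. x * _"] cong: if_cong)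
qed

lemma smooth_in_partial:
  assumes "smooth_in \<phi> f"
  shows "smooth_in \<phi> (partial \<phi> a f)"
proof -
  have "smooth_on (coord \<phi> ` chart_dom \<phi>) (f \<circ> coord_inv \<phi>)"
    using assms by (simp add: smooth_in_def)
  from smooth_on_frechet_derivative[OF this, of "axis a 1"] show ?thesis
    unfolding smooth_in_def
    by (rule smooth_on_cong[rotated])
      (auto simp: partial_def coord_inv_coord at_within_open[OF _ open_im])
qed

text \<open>The product rule for one component of \<open>\<tau>\<^sup>-\<^sup>2 G\<close>; the term
  with \<open>2 * partial \<phi> a \<tau> p / \<tau> p\<close> is the source of all later conformal
  corrections.\<close>

lemma partial_inverse_square_mult:
  fixes f :: "'m \<Rightarrow> real"
  assumes "smooth_in \<phi> f" "smooth_in \<phi> \<tau>" "p \<in> chart_dom \<phi>" "\<tau> p \<noteq> 0"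
    and "\<And>q. q \<in> chart_dom \<phi> \<Longrightarrow> h q = inverse ((\<tau> q)\<^sup>2) * f q"
  shows "partial \<phi> a h p = inverse ((\<tau> p)\<^sup>2) * (partial \<phi> a f p - 2 * partial \<phi> a \<tau> p / \<tau> p * f p)"
proof -
  let ?Df = "\<lambda>v. \<Sum>a\<in>UNIV. v $ a * partial \<phi> a f p" and ?Dt = "\<lambda>v. \<Sum>a\<in>UNIV. v $ a * partial \<phi> a \<tau> p"
  note f = smooth_in_has_derivative[OF assms(1,3)]
  note t = smooth_in_has_derivative[OF assms(2,3)]
  have p: "(f \<circ> coord_inv \<phi>) (coord \<phi> p) = f p" "(\<tau> \<circ> coord_inv \<phi>) (coord \<phi> p) = \<tau> p"
    using coord_inv_coord[OF assms(3)] by auto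
  have "((\<lambda>x. inverse (((\<tau> \<circ> coord_inv \<phi>) x)\<^sup>2)) has_derivative
      (\<lambda>v. - (inverse ((\<tau> p)\<^sup>2) * (2 * ?Dt v * \<tau> p) * inverse ((\<tau> p)\<^sup>2)))) (at (coord \<phi> p))"
    using Deriv.has_derivative_inverse[OF _ has_derivative_power[OF t, of 2]] assms(4) p by simp
  from has_derivative_mult[OF this f] have
    d: "((\<lambda>x. inverse (((\<tau> \<circ> coord_inv \<phi>) x)\<^sup>2) * (f \<circ> coord_inv \<phi>) x) has_derivative
      (\<lambda>v. inverse ((\<tau> p)\<^sup>2) * ?Df v +
        - (inverse ((\<tau> p)\<^sup>2) * (2 * ?Dt v * \<tau> p) * inverse ((\<tau> p)\<^sup>2)) * f p)) (at (coord \<phi> p))"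
    unfolding p .
  have "(h \<circ> coord_inv \<phi> has_derivative (\<lambda>v. inverse ((\<tau> p)\<^sup>2) * ?Df v +
        - (inverse ((\<tau> p)\<^sup>2) * (2 * ?Dt v * \<tau> p) * inverse ((\<tau> p)\<^sup>2)) * f p)) (at (coord \<phi> p))"
    by (rule has_derivative_transform_within_open[OF d open_im])
      (use assms(3,5) coord_inv_coord in auto)
  from partial_eqI[OF this, of a] show ?thesis
    using assms(4)
    by (simp add: axis_def if_distrib[of "\<lambda>x. x * _"] cong: if_cong)
      (simp add: field_simps power2_eq_square)
qed

end

section \<open>Christoffel symbols and conformal changes\<close>

definition metric_derivative ::
  "('m, 'n::finite) form_field \<Rightarrow> ('m, 'n) chart \<Rightarrow> 'm \<Rightarrow> real^'n \<Rightarrow> real^'n^'n" where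
  "metric_derivative h \<phi> p v = (\<chi> b c. \<Sum>a\<in>UNIV. v $ a * partial \<phi> a (\<lambda>q. h \<phi> q $ b $ c) p)"

text \<open>The gradient of \<open>q \<mapsto> h\<^sub>q(v, v)\<close> with the components of \<open>v\<close> held constant.\<close>

definition square_gradient ::
  "('m, 'n::finite) form_field \<Rightarrow> ('m, 'n) chart \<Rightarrow> 'm \<Rightarrow> real^'n \<Rightarrow> real^'n" where
  "square_gradient h \<phi> p v =
     (\<chi> b. \<Sum>a\<in>UNIV. \<Sum>c\<in>UNIV. v $ a * v $ c * partial \<phi> b (\<lambda>q. h \<phi> q $ a $ c) p)"

lemma matrix_inv_mult:
  fixes M :: "real^'n^'n"
  assumes "invertible M"
  shows "M ** matrix_inv M = mat 1" "matrix_inv M ** M = mat 1"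
  using someI_ex[OF assms[unfolded invertible_def]] unfolding matrix_inv_def by auto

lemma matrix_inv_eqI:
  fixes M N :: "real^'n^'n"
  assumes "M ** N = mat 1"
  shows "matrix_inv M = N"
proof -
  have "invertible M"
    using assms by (simp add: invertible_right_inverse[of M] exI[of _ N])
  then show ?thesis
    using matrix_inv_mult(2)[of M] assms by (metis matrix_mul_assoc matrix_mul_lid matrix_mul_rid)
qed

lemma matrix_inv_scaleR:
  fixes M :: "real^'n^'n"
  assumes "invertible M" "r \<noteq> 0"
  shows "matrix_inv (r *\<^sub>R M) = inverse r *\<^sub>R matrix_inv M"
proof -
  have "r *\<^sub>R M ** (inverse r *\<^sub>R matrix_inv M) = mat 1"
    "inverse r *\<^sub>R matrix_inv M ** (r *\<^sub>R M) = mat 1"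
    using matrix_inv_mult[OF assms(1)] assms(2)
    by (simp_all add: scalar_matrix_assoc matrix_scalar_ac flip: scalar_mult_eq_scaleR)
  then show ?thesis
    by (simp add: matrix_inv_eqI)
qed

text \<open>Lowering the upper index cancels the inverse metric and leaves the Christoffel symbols
  of the first kind.\<close>

lemma christoffel_lower:
  assumes "invertible (h \<phi> p)"
  shows "(\<Sum>a\<in>UNIV. h \<phi> p $ e $ a * christoffel h \<phi> p a b c) =
    1/2 * (partial \<phi> b (\<lambda>q. h \<phi> q $ e $ c) p + partial \<phi> c (\<lambda>q. h \<phi> q $ e $ b) p
      - partial \<phi> e (\<lambda>q. h \<phi> q $ b $ c) p)"
proof -
  define f where "f d = partial \<phi> b (\<lambda>q. h \<phi> q $ d $ c) p + partial \<phi> c (\<lambda>q. h \<phi> q $ d $ b) p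
      - partial \<phi> d (\<lambda>q. h \<phi> q $ b $ c) p" for d
  have m: "(\<Sum>a\<in>UNIV. h \<phi> p $ e $ a * matrix_inv (h \<phi> p) $ a $ d) = (if e = d then 1 else 0)" for d
    using arg_cong[OF matrix_inv_mult(1)[OF assms], of "\<lambda>M. M $ e $ d"]
    by (simp add: matrix_matrix_mult_def mat_def)
  have "(\<Sum>a\<in>UNIV. h \<phi> p $ e $ a * christoffel h \<phi> p a b c) =
      (\<Sum>a\<in>UNIV. \<Sum>d\<in>UNIV. 1/2 * (h \<phi> p $ e $ a * matrix_inv (h \<phi> p) $ a $ d * f d))"
    unfolding christoffel_def f_def[symmetric] by (simp add: sum_distrib_left mult_ac)
  also have "\<dots> = 1/2 * (\<Sum>d\<in>UNIV. (\<Sum>a\<in>UNIV. h \<phi> p $ e $ a * matrix_inv (h \<phi> p) $ a $ d) * f d)"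
    by (subst sum.swap) (simp add: sum_distrib_left sum_distrib_right mult_ac)
  also have "\<dots> = 1/2 * f e"
    unfolding m by (simp add: if_distrib[of "\<lambda>x. x * _"] cong: if_cong)
  finally show ?thesis
    unfolding f_def .
qed

locale chart_metric = manifold_chart \<A> \<phi>
  for \<A> :: "('m::{second_countable_topology,t2_space}, 'n::finite) chart set" and \<phi> +
  fixes h :: "('m, 'n) form_field"
  assumes smooth: "smooth_in \<phi> (h \<phi>)"
    and symmetric: "p \<in> chart_dom \<phi> \<Longrightarrow> transpose (h \<phi> p) = h \<phi> p"
    and invertible: "p \<in> chart_dom \<phi> \<Longrightarrow> invertible (h \<phi> p)"
begin

lemma smooth_entry: "smooth_in \<phi> (\<lambda>q. h \<phi> q $ a $ b)"
  using smooth_in_bounded_linear[OF smooth, of "\<lambda>M. M $ a $ b"]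
  by (simp add: bounded_linear_compose[OF bounded_linear_vec_nth bounded_linear_vec_nth])

lemma entry_commute: "p \<in> chart_dom \<phi> \<Longrightarrow> h \<phi> p $ a $ b = h \<phi> p $ b $ a"
  using arg_cong[OF symmetric, of p "\<lambda>M. M $ b $ a"] by (simp add: Finite_Cartesian_Product.transpose_def)

lemma partial_entry_commute:
  "p \<in> chart_dom \<phi> \<Longrightarrow> partial \<phi> c (\<lambda>q. h \<phi> q $ a $ b) p = partial \<phi> c (\<lambda>q. h \<phi> q $ b $ a) p"
  by (rule partial_cong[OF smooth_entry]) (auto intro: entry_commute)

lemma inv_entry_commute:
  assumes "p \<in> chart_dom \<phi>"
  shows "matrix_inv (h \<phi> p) $ a $ b = matrix_inv (h \<phi> p) $ b $ a"
proof -
  note m = matrix_inv_mult[OF invertible[OF assms]]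
  have "h \<phi> p ** transpose (matrix_inv (h \<phi> p)) = mat 1" "transpose (matrix_inv (h \<phi> p)) ** h \<phi> p = mat 1"
    using m symmetric[OF assms] by (metis matrix_transpose_mul transpose_mat)+
  then have "matrix_inv (h \<phi> p) = transpose (matrix_inv (h \<phi> p))"
    by (intro matrix_inv_eqI)
  from arg_cong[OF this, of "\<lambda>M. M $ a $ b"] show ?thesis
    by (simp add: Finite_Cartesian_Product.transpose_def)
qed

text \<open>Contracted twice with \<open>v\<close>, the first two terms of the lowered symbol
  coincide. This is the quadratic term of the acceleration, with its index lowered.\<close>

lemma lower_christoffel_square:
  assumes "p \<in> chart_dom \<phi>"
  shows "h \<phi> p *v (\<chi> b. \<Sum>a\<in>UNIV. \<Sum>c\<in>UNIV. christoffel h \<phi> p b a c * v $ a * v $ c) =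
    metric_derivative h \<phi> p v *v v - (1/2) *\<^sub>R square_gradient h \<phi> p v"
  unfolding vec_eq_iff
proof
  fix e
  let ?d = "\<lambda>a b c. partial \<phi> a (\<lambda>q. h \<phi> q $ b $ c) p"
  have "(h \<phi> p *v (\<chi> b. \<Sum>a\<in>UNIV. \<Sum>c\<in>UNIV. christoffel h \<phi> p b a c * v $ a * v $ c)) $ e =
      (\<Sum>b\<in>UNIV. \<Sum>a\<in>UNIV. \<Sum>c\<in>UNIV. v $ a * v $ c * (h \<phi> p $ e $ b * christoffel h \<phi> p b a c))"
    by (simp add: matrix_vector_mult_def sum_distrib_left mult_ac)
  also have "\<dots> = (\<Sum>a\<in>UNIV. \<Sum>b\<in>UNIV. \<Sum>c\<in>UNIV. v $ a * v $ c * (h \<phi> p $ e $ b * christoffel h \<phi> p b a c))"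
    by (rule sum.swap)
  also have "\<dots> = (\<Sum>a\<in>UNIV. \<Sum>c\<in>UNIV. \<Sum>b\<in>UNIV. v $ a * v $ c * (h \<phi> p $ e $ b * christoffel h \<phi> p b a c))"
    by (intro sum.cong refl sum.swap)
  also have "\<dots> = (\<Sum>a\<in>UNIV. \<Sum>c\<in>UNIV. v $ a * v $ c * (1/2 * (?d a e c + ?d c e a - ?d e a c)))"
    by (simp only: sum_distrib_left[symmetric] christoffel_lower[where h = h and \<phi> = \<phi>, OF invertible[OF assms]])
  also have "\<dots> = 1/2 * (\<Sum>a\<in>UNIV. \<Sum>c\<in>UNIV. v $ a * v $ c * ?d a e c)
      + 1/2 * (\<Sum>a\<in>UNIV. \<Sum>c\<in>UNIV. v $ a * v $ c * ?d c e a)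
      - 1/2 * (\<Sum>a\<in>UNIV. \<Sum>c\<in>UNIV. v $ a * v $ c * ?d e a c)"
    by (simp add: sum_distrib_left sum_subtractf sum.distrib algebra_simps)
  also have "(\<Sum>a\<in>UNIV. \<Sum>c\<in>UNIV. v $ a * v $ c * ?d c e a) = (\<Sum>a\<in>UNIV. \<Sum>c\<in>UNIV. v $ a * v $ c * ?d a e c)"
    by (subst sum.swap) (simp add: mult_ac)
  also have "(\<Sum>a\<in>UNIV. \<Sum>c\<in>UNIV. v $ a * v $ c * ?d a e c) = (metric_derivative h \<phi> p v *v v) $ e"
    unfolding metric_derivative_def
    by (subst sum.swap) (simp add: matrix_vector_mult_def sum_distrib_left mult_ac)
  finally show "(h \<phi> p *v (\<chi> b. \<Sum>a\<in>UNIV. \<Sum>c\<in>UNIV. christoffel h \<phi> p b a c * v $ a * v $ c)) $ e =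
      (metric_derivative h \<phi> p v *v v - (1/2) *\<^sub>R square_gradient h \<phi> p v) $ e"
    by (simp add: square_gradient_def)
qed

text \<open>Here \<open>v\<close> is contracted with one lower index and, lowered, with the upper
  one, so two of the three terms cancel. This is the correction in the covariant derivative of the
  covector \<open>h v\<close> along \<open>v\<close>.\<close>

lemma christoffel_lower_square:
  assumes "p \<in> chart_dom \<phi>"
  shows "(\<chi> b. \<Sum>a\<in>UNIV. \<Sum>c\<in>UNIV. christoffel h \<phi> p c a b * v $ a * (h \<phi> p *v v) $ c) =
    (1/2) *\<^sub>R square_gradient h \<phi> p v"
  unfolding vec_eq_iff
proof
  fix b
  let ?d = "\<lambda>a b c. partial \<phi> a (\<lambda>q. h \<phi> q $ b $ c) p"
  have "(\<Sum>a\<in>UNIV. \<Sum>c\<in>UNIV. christoffel h \<phi> p c a b * v $ a * (h \<phi> p *v v) $ c) =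
      (\<Sum>a\<in>UNIV. \<Sum>c\<in>UNIV. \<Sum>e\<in>UNIV. v $ a * v $ e * (h \<phi> p $ e $ c * christoffel h \<phi> p c a b))"
    by (simp add: matrix_vector_mult_def sum_distrib_left mult_ac entry_commute[OF assms])
  also have "\<dots> = (\<Sum>a\<in>UNIV. \<Sum>e\<in>UNIV. \<Sum>c\<in>UNIV. v $ a * v $ e * (h \<phi> p $ e $ c * christoffel h \<phi> p c a b))"
    by (intro sum.cong refl sum.swap)
  also have "\<dots> = (\<Sum>a\<in>UNIV. \<Sum>e\<in>UNIV. v $ a * v $ e * (1/2 * (?d a e b + ?d b e a - ?d e a b)))"
    by (simp only: sum_distrib_left[symmetric] christoffel_lower[where h = h and \<phi> = \<phi>, OF invertible[OF assms]])
  also have "\<dots> = 1/2 * (\<Sum>a\<in>UNIV. \<Sum>e\<in>UNIV. v $ a * v $ e * ?d a e b)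
      + 1/2 * (\<Sum>a\<in>UNIV. \<Sum>e\<in>UNIV. v $ a * v $ e * ?d b e a)
      - 1/2 * (\<Sum>a\<in>UNIV. \<Sum>e\<in>UNIV. v $ a * v $ e * ?d e a b)"
    by (simp add: sum_distrib_left sum_subtractf sum.distrib algebra_simps)
  also have "(\<Sum>a\<in>UNIV. \<Sum>e\<in>UNIV. v $ a * v $ e * ?d e a b) = (\<Sum>a\<in>UNIV. \<Sum>e\<in>UNIV. v $ a * v $ e * ?d a e b)"
    by (subst sum.swap) (simp add: mult_ac)
  also have "(\<Sum>a\<in>UNIV. \<Sum>e\<in>UNIV. v $ a * v $ e * ?d b e a) = (\<Sum>a\<in>UNIV. \<Sum>e\<in>UNIV. v $ a * v $ e * ?d b a e)"
    by (intro sum.cong refl arg_cong2[where f = "(*)"] partial_entry_commute assms)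
  finally show "(\<chi> b. \<Sum>a\<in>UNIV. \<Sum>c\<in>UNIV. christoffel h \<phi> p c a b * v $ a * (h \<phi> p *v v) $ c) $ b =
      ((1/2) *\<^sub>R square_gradient h \<phi> p v) $ b"
    by (simp add: square_gradient_def)
qed

text \<open>The last two terms of the symbol cancel in the trace because the metric and its inverse
  are symmetric.\<close>

lemma christoffel_trace:
  assumes "p \<in> chart_dom \<phi>"
  shows "(\<Sum>b\<in>UNIV. christoffel h \<phi> p b a b) =
    1/2 * (\<Sum>b\<in>UNIV. \<Sum>d\<in>UNIV. matrix_inv (h \<phi> p) $ b $ d * partial \<phi> a (\<lambda>q. h \<phi> q $ d $ b) p)"
proof -
  let ?d = "\<lambda>a b c. partial \<phi> a (\<lambda>q. h \<phi> q $ b $ c) p" and ?i = "\<lambda>b d. matrix_inv (h \<phi> p) $ b $ d"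
  have "(\<Sum>b\<in>UNIV. christoffel h \<phi> p b a b) = 1/2 * ((\<Sum>b\<in>UNIV. \<Sum>d\<in>UNIV. ?i b d * ?d a d b)
      + (\<Sum>b\<in>UNIV. \<Sum>d\<in>UNIV. ?i b d * ?d b d a) - (\<Sum>b\<in>UNIV. \<Sum>d\<in>UNIV. ?i b d * ?d d a b))"
    unfolding christoffel_def by (simp add: sum_distrib_left sum_subtractf sum.distrib algebra_simps)
  also have "(\<Sum>b\<in>UNIV. \<Sum>d\<in>UNIV. ?i b d * ?d b d a) = (\<Sum>b\<in>UNIV. \<Sum>d\<in>UNIV. ?i b d * ?d d a b)"
    by (subst sum.swap) (intro sum.cong refl arg_cong2[where f = "(*)"] partial_entry_commute
        inv_entry_commute assms)
  finally show ?thesis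
    by simp
qed

text \<open>The left-hand side is the trace of the inverse metric times its derivative, that is, the
  derivative of the logarithm of \<open>\<bar>det h\<bar>\<close>. Multiplying by the inverse at
  \<open>p\<close> reduces this to Jacobi's formula at the identity.\<close>

lemma det_derivative:
  assumes "p \<in> chart_dom \<phi>" "\<And>q. q \<in> chart_dom \<phi> \<Longrightarrow> \<bar>det (h \<phi> q)\<bar> = 1"
  shows "(\<Sum>b\<in>UNIV. \<Sum>d\<in>UNIV. matrix_inv (h \<phi> p) $ b $ d * partial \<phi> a (\<lambda>q. h \<phi> q $ d $ b) p) = 0"
proof -
  define B where "B x = matrix_inv (h \<phi> p) ** h \<phi> (coord_inv \<phi> x)" for x
  define D where "D v = matrix_inv (h \<phi> p) ** metric_derivative h \<phi> p v" for v
  let ?x = "coord \<phi> p"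
  have x: "?x \<in> coord \<phi> ` chart_dom \<phi>"
    using assms(1) by simp
  have B1: "B ?x = mat 1"
    unfolding B_def coord_inv_coord[OF assms(1)] by (rule matrix_inv_mult(2)[OF invertible[OF assms(1)]])
  have "((\<lambda>x. B x $ i $ j) has_derivative (\<lambda>v. D v $ i $ j)) (at ?x)" for i j
  proof -
    have "((\<lambda>x. \<Sum>k\<in>UNIV. matrix_inv (h \<phi> p) $ i $ k * ((\<lambda>q. h \<phi> q $ k $ j) \<circ> coord_inv \<phi>) x)
        has_derivative (\<lambda>v. \<Sum>k\<in>UNIV. matrix_inv (h \<phi> p) $ i $ k *
          (\<Sum>a\<in>UNIV. v $ a * partial \<phi> a (\<lambda>q. h \<phi> q $ k $ j) p))) (at ?x)"
      by (intro has_derivative_sum has_derivative_mult_right smooth_in_has_derivative smooth_entry assms(1))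
    then show ?thesis
      by (simp add: B_def D_def matrix_matrix_mult_def metric_derivative_def)
  qed
  from has_derivative_det_mat_1[OF this B1]
  have d: "((\<lambda>x. det (B x)) has_derivative (\<lambda>v. trace (D v))) (at ?x)" .
  \<comment> \<open>Squaring removes the sign: only the absolute value of the determinant is known
    to be constant.\<close>
  have c: "((\<lambda>x. (det (B x))\<^sup>2) has_derivative (\<lambda>v. 0)) (at ?x)"
  proof (rule has_derivative_transform_within_open[OF has_derivative_const[of "(det (matrix_inv (h \<phi> p)))\<^sup>2"] open_im x])
    fix x assume "x \<in> coord \<phi> ` chart_dom \<phi>"
    then obtain q where q: "q \<in> chart_dom \<phi>" "x = coord \<phi> q" by blast
    have "(det (h \<phi> q))\<^sup>2 = 1"
      using assms(2)[OF q(1)] by (metis one_power2 power2_abs)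
    then show "(det (matrix_inv (h \<phi> p)))\<^sup>2 = (det (B x))\<^sup>2"
      unfolding B_def q(2) coord_inv_coord[OF q(1)] by (simp add: det_mul power_mult_distrib)
  qed
  have "((\<lambda>x. (det (B x))\<^sup>2) has_derivative (\<lambda>v. 2 * trace (D v))) (at ?x)"
    using has_derivative_power[OF d, of 2] by (simp add: B1)
  from has_derivative_unique[OF this c] have "2 * trace (D (axis a 1)) = 0"
    by metis
  then show ?thesis
    by (simp add: D_def trace_def matrix_matrix_mult_def metric_derivative_def axis_def
        if_distrib[of "\<lambda>x. x * _"] cong: if_cong)
qed

end

section \<open>Comparison of a metric of the class with the conformal metric\<close>

definition gradient :: "('m, 'n::finite) chart \<Rightarrow> ('m \<Rightarrow> real) \<Rightarrow> 'm \<Rightarrow> real^'n" where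
  "gradient \<phi> f p = (\<chi> a. partial \<phi> a f p)"

locale chart_scale = G: chart_metric \<A> \<phi> G + h: chart_metric \<A> \<phi> h
  for \<A> :: "('m::{second_countable_topology,t2_space}, 'n::finite) chart set" and \<phi> G h +
  fixes \<tau> :: "'m \<Rightarrow> real"
  assumes det_G: "p \<in> chart_dom \<phi> \<Longrightarrow> \<bar>det (G \<phi> p)\<bar> = 1"
    and smooth_scale: "smooth_in \<phi> \<tau>"
    and scale_pos: "p \<in> chart_dom \<phi> \<Longrightarrow> \<tau> p > 0"
    and scale: "p \<in> chart_dom \<phi> \<Longrightarrow> h \<phi> p = inverse ((\<tau> p)\<^sup>2) *\<^sub>R G \<phi> p"
begin

lemma partial_scale:
  assumes "p \<in> chart_dom \<phi>"
  shows "partial \<phi> a (\<lambda>q. h \<phi> q $ b $ c) p = inverse ((\<tau> p)\<^sup>2) *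
    (partial \<phi> a (\<lambda>q. G \<phi> q $ b $ c) p - 2 * partial \<phi> a \<tau> p / \<tau> p * G \<phi> p $ b $ c)"
  by (rule G.partial_inverse_square_mult[OF G.smooth_entry smooth_scale assms])
    (use scale scale_pos[OF assms] in auto)

lemma metric_derivative_scale:
  assumes "p \<in> chart_dom \<phi>"
  shows "metric_derivative h \<phi> p v = inverse ((\<tau> p)\<^sup>2) *\<^sub>R
    (metric_derivative G \<phi> p v - (2 * (v \<bullet> gradient \<phi> \<tau> p) / \<tau> p) *\<^sub>R G \<phi> p)"
  unfolding vec_eq_iff metric_derivative_def partial_scale[OF assms] gradient_def
  by (simp add: inner_vec_def sum_distrib_left sum_distrib_right sum_subtractf sum_divide_distrib algebra_simps)

lemma square_gradient_scale:
  assumes "p \<in> chart_dom \<phi>"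
  shows "square_gradient h \<phi> p v = inverse ((\<tau> p)\<^sup>2) *\<^sub>R
    (square_gradient G \<phi> p v - (2 * (v \<bullet> (G \<phi> p *v v)) / \<tau> p) *\<^sub>R gradient \<phi> \<tau> p)"
  unfolding vec_eq_iff square_gradient_def partial_scale[OF assms] gradient_def
  by (simp add: inner_vec_def matrix_vector_mult_def sum_distrib_left sum_distrib_right sum_subtractf
      sum_divide_distrib algebra_simps)

text \<open>Lowering with \<open>G\<close> instead of \<open>h\<close> supplies the factor that
  cancels \<open>\<tau>\<^sup>-\<^sup>2\<close>. What remains is the expression for \<open>G\<close>
  plus terms in the gradient of \<open>\<tau>\<close>.\<close>

lemma lower_christoffel_scale:
  assumes "p \<in> chart_dom \<phi>"
  shows "G \<phi> p *v (\<chi> b. \<Sum>a\<in>UNIV. \<Sum>c\<in>UNIV. christoffel h \<phi> p b a c * v $ a * v $ c) =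
    metric_derivative G \<phi> p v *v v - (2 * (v \<bullet> gradient \<phi> \<tau> p) / \<tau> p) *\<^sub>R (G \<phi> p *v v)
      - (1/2) *\<^sub>R square_gradient G \<phi> p v + ((v \<bullet> (G \<phi> p *v v)) / \<tau> p) *\<^sub>R gradient \<phi> \<tau> p"
proof -
  let ?c = "\<chi> b. \<Sum>a\<in>UNIV. \<Sum>c\<in>UNIV. christoffel h \<phi> p b a c * v $ a * v $ c"
  have t: "(\<tau> p)\<^sup>2 \<noteq> 0" using scale_pos[OF assms] by simp
  have "G \<phi> p = (\<tau> p)\<^sup>2 *\<^sub>R h \<phi> p"
    using scale[OF assms] t by simp
  have e: "(\<tau> p)\<^sup>2 *\<^sub>R ((inverse ((\<tau> p)\<^sup>2) *\<^sub>R M) *v v - (1/2) *\<^sub>R (inverse ((\<tau> p)\<^sup>2) *\<^sub>R x)) =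
      M *v v - (1/2) *\<^sub>R x" for M x
    using t by (simp add: scaleR_right_diff_distrib scaleR_matrix_vector_assoc mult.left_commute[of "1/2"]
        mult.assoc[symmetric])
  from \<open>G \<phi> p = _\<close> have "G \<phi> p *v ?c = (\<tau> p)\<^sup>2 *\<^sub>R (h \<phi> p *v ?c)"
    by (simp add: scaleR_matrix_vector_assoc)
  also have "\<dots> = (\<tau> p)\<^sup>2 *\<^sub>R (metric_derivative h \<phi> p v *v v - (1/2) *\<^sub>R square_gradient h \<phi> p v)"
    by (simp only: h.lower_christoffel_square[OF assms])
  also have "\<dots> = (metric_derivative G \<phi> p v - (2 * (v \<bullet> gradient \<phi> \<tau> p) / \<tau> p) *\<^sub>R G \<phi> p) *v v -
      (1/2) *\<^sub>R (square_gradient G \<phi> p v - (2 * (v \<bullet> (G \<phi> p *v v)) / \<tau> p) *\<^sub>R gradient \<phi> \<tau> p)"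
    unfolding metric_derivative_scale[OF assms] square_gradient_scale[OF assms] e ..
  finally show ?thesis
    by (simp add: matrix_vector_mult_diff_rdistrib scaleR_matrix_vector_assoc[symmetric] scaleR_right_diff_distrib)
qed

lemma christoffel_lower_scale:
  assumes "p \<in> chart_dom \<phi>"
  shows "(\<chi> b. \<Sum>a\<in>UNIV. \<Sum>c\<in>UNIV. christoffel h \<phi> p c a b * v $ a * (G \<phi> p *v v) $ c) =
    (1/2) *\<^sub>R square_gradient G \<phi> p v - ((v \<bullet> (G \<phi> p *v v)) / \<tau> p) *\<^sub>R gradient \<phi> \<tau> p"
proof -
  have t: "(\<tau> p)\<^sup>2 \<noteq> 0" using scale_pos[OF assms] by simp
  have "G \<phi> p = (\<tau> p)\<^sup>2 *\<^sub>R h \<phi> p"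
    using scale[OF assms] t by simp
  then have "G \<phi> p *v v = (\<tau> p)\<^sup>2 *\<^sub>R (h \<phi> p *v v)"
    by (simp add: scaleR_matrix_vector_assoc)
  then have "(\<chi> b. \<Sum>a\<in>UNIV. \<Sum>c\<in>UNIV. christoffel h \<phi> p c a b * v $ a * (G \<phi> p *v v) $ c) =
      (\<tau> p)\<^sup>2 *\<^sub>R (\<chi> b. \<Sum>a\<in>UNIV. \<Sum>c\<in>UNIV. christoffel h \<phi> p c a b * v $ a * (h \<phi> p *v v) $ c)"
    by (simp add: vec_eq_iff sum_distrib_left mult_ac)
  also have "\<dots> = (\<tau> p)\<^sup>2 *\<^sub>R (1/2) *\<^sub>R square_gradient h \<phi> p v"
    by (simp only: h.christoffel_lower_square[OF assms])
  also have "\<dots> = (1/2) *\<^sub>R (square_gradient G \<phi> p v - (2 * (v \<bullet> (G \<phi> p *v v)) / \<tau> p) *\<^sub>R gradient \<phi> \<tau> p)"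
    unfolding square_gradient_scale[OF assms]
    using t by (simp add: mult.left_commute[of "1/2"] mult.assoc[symmetric])
  finally show ?thesis
    by (simp add: scaleR_right_diff_distrib)
qed

text \<open>Equivalently, \<open>\<tau>\<close> is parallel as a 1-density for the connection of
  \<open>h\<close>.\<close>

lemma density_form_scale:
  assumes "p \<in> chart_dom \<phi>"
  shows "density_form 1 h \<phi> p = - (1 / \<tau> p) *\<^sub>R gradient \<phi> \<tau> p"
  unfolding vec_eq_iff
proof
  fix a
  have t: "\<tau> p \<noteq> 0" using scale_pos[OF assms] by simp
  let ?i = "\<lambda>b d. matrix_inv (G \<phi> p) $ b $ d"
  have i: "matrix_inv (h \<phi> p) = (\<tau> p)\<^sup>2 *\<^sub>R matrix_inv (G \<phi> p)"
    unfolding scale[OF assms] using matrix_inv_scaleR[OF G.invertible[OF assms], of "inverse ((\<tau> p)\<^sup>2)"] t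
    by simp
  have e: "(\<tau> p)\<^sup>2 * x * (inverse ((\<tau> p)\<^sup>2) * y) = x * y" for x y
    using t by (simp add: field_simps)
  \<comment> \<open>The trace of the identity is the dimension, which cancels the \<open>1/n\<close>
    in \<open>density_form\<close>.\<close>
  have 1: "(\<Sum>b\<in>UNIV. \<Sum>d\<in>UNIV. ?i b d * G \<phi> p $ d $ b) = real CARD('n)"
  proof -
    have "(\<Sum>d\<in>UNIV. ?i b d * G \<phi> p $ d $ b) = 1" for b
      using arg_cong[OF matrix_inv_mult(2)[OF G.invertible[OF assms]], of "\<lambda>M. M $ b $ b"]
      by (simp add: matrix_matrix_mult_def mat_def)
    then show ?thesis by simp
  qed
  \<comment> \<open>The normalisation of the conformal metric enters here.\<close>
  have 0: "(\<Sum>b\<in>UNIV. \<Sum>d\<in>UNIV. ?i b d * partial \<phi> a (\<lambda>q. G \<phi> q $ d $ b) p) = 0"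
    by (rule G.det_derivative[OF assms det_G])
  have "(\<Sum>b\<in>UNIV. christoffel h \<phi> p b a b) = 1/2 * (\<Sum>b\<in>UNIV. \<Sum>d\<in>UNIV.
      ?i b d * (partial \<phi> a (\<lambda>q. G \<phi> q $ d $ b) p - 2 * partial \<phi> a \<tau> p / \<tau> p * G \<phi> p $ d $ b))"
    unfolding h.christoffel_trace[OF assms] i partial_scale[OF assms]
      vector_scaleR_component real_scaleR_def e ..
  also have "\<dots> = 1/2 * ((\<Sum>b\<in>UNIV. \<Sum>d\<in>UNIV. ?i b d * partial \<phi> a (\<lambda>q. G \<phi> q $ d $ b) p)
      - 2 * partial \<phi> a \<tau> p / \<tau> p * (\<Sum>b\<in>UNIV. \<Sum>d\<in>UNIV. ?i b d * G \<phi> p $ d $ b))"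
    by (simp add: sum_distrib_left sum_subtractf algebra_simps)
  also have "\<dots> = - real CARD('n) * partial \<phi> a \<tau> p / \<tau> p"
    unfolding 1 0 by simp
  finally show "density_form 1 h \<phi> p $ a = (- (1 / \<tau> p) *\<^sub>R gradient \<phi> \<tau> p) $ a"
    by (simp add: density_form_def gradient_def)
qed

end

section \<open>Curves in a chart\<close>

locale chart_curve = manifold_chart \<A> \<phi>
  for \<A> :: "('m::{second_countable_topology,t2_space}, 'n::finite) chart set" and \<phi> +
  fixes S :: "real set" and \<gamma> :: "real \<Rightarrow> 'm"
  assumes curve: "smooth_regular_curve \<A> S \<gamma>"
begin

definition dom :: "real set" where "dom = {t \<in> S. \<gamma> t \<in> chart_dom \<phi>}"

abbreviation u :: "real \<Rightarrow> real^'n" where "u \<equiv> velocity S \<gamma> \<phi>"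

definition w :: "real \<Rightarrow> real^'n" where "w t = vector_derivative u (at t within S)"

lemma dom_relatively_open: "\<exists>O'. open O' \<and> dom = S \<inter> O'"
proof -
  have "continuous_on S \<gamma>"
    using curve by (simp add: smooth_regular_curve_def)
  then have "openin (top_of_set S) (S \<inter> \<gamma> -` chart_dom \<phi>)"
    using open_dom continuous_openin_preimage_gen by blast
  then show ?thesis
    unfolding openin_open dom_def by (auto simp: vimage_def Int_def)
qed

text \<open>Derivatives within \<open>S\<close> are local, so the part of the curve inside the chart
  determines them.\<close>

lemma at_dom:
  assumes "t \<in> dom"
  shows "at t within S = at t within dom"
proof -
  obtain O' where "open O'" "dom = S \<inter> O'"
    using dom_relatively_open by blast
  then show ?thesis
    using assms by (intro at_within_nhd[of t O']) auto
qed

text \<open>An interval with nonempty interior has no isolated points, so derivatives are unique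
  also at endpoints.\<close>

lemma at_dom_nontrivial:
  assumes "t \<in> dom"
  shows "at t within dom \<noteq> bot"
proof -
  have S: "is_interval S" "interior S \<noteq> {}" and t: "t \<in> S"
    using curve assms by (simp_all add: smooth_regular_curve_def dom_def)
  have "\<not> S \<subseteq> {t}"
    using S(2) interior_mono[of S "{t}"] by (auto simp: interior_singleton)
  then have "t islimpt S"
    using connected_imp_perfect[of S t] S(1) t is_interval_connected by blast
  then show ?thesis
    unfolding at_dom[OF assms, symmetric] by (simp add: trivial_limit_within)
qed

lemma smooth_coord: "smooth_on dom (coord \<phi> \<circ> \<gamma>)"
  using curve chart by (auto simp: smooth_regular_curve_def dom_def)

lemma smooth_velocity: "smooth_on dom u"
  by (rule smooth_on_cong[OF _ smooth_on_vector_derivative[OF smooth_coord at_dom_nontrivial]])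
    (simp add: velocity_def at_dom)

lemma smooth_w: "smooth_on dom w"
  by (rule smooth_on_cong[OF _ smooth_on_vector_derivative[OF smooth_velocity at_dom_nontrivial]])
    (simp add: w_def at_dom)

lemma velocity_nonzero: "t \<in> dom \<Longrightarrow> u t \<noteq> 0"
  using curve chart by (auto simp: smooth_regular_curve_def dom_def)

lemma has_velocity:
  assumes "t \<in> dom"
  shows "(coord \<phi> \<circ> \<gamma> has_vector_derivative u t) (at t within dom)"
  using smooth_on_has_vector_derivative(1)[OF smooth_coord assms at_dom_nontrivial[OF assms]]
  by (simp add: velocity_def at_dom[OF assms])

lemma velocity_derivative:
  assumes "t \<in> dom"
  shows "((\<lambda>s. u s $ a) has_real_derivative w t $ a) (at t within dom)"
  using smooth_on_has_vector_derivative(1)[OF smooth_velocity assms at_dom_nontrivial[OF assms]]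
  by (simp add: w_def at_dom[OF assms] has_vector_derivative_vec_iff)

text \<open>The third derivative of the curve is needed because the bottom slot of \<open>U\<close>
  contains \<open>w\<close>, and \<open>A\<close> differentiates \<open>U\<close> once more.\<close>

lemma w_differentiable:
  assumes "t \<in> dom"
  shows "(\<lambda>s. w s $ a) differentiable (at t within dom)"
  using smooth_on_has_vector_derivative(1)[OF smooth_w assms at_dom_nontrivial[OF assms]]
  by (auto simp: has_vector_derivative_vec_iff real_differentiable_def)

lemma along_curve:
  fixes f :: "'m \<Rightarrow> real"
  assumes "smooth_in \<phi> f" "t \<in> dom"
  shows "((\<lambda>s. f (\<gamma> s)) has_real_derivative (u t \<bullet> gradient \<phi> f (\<gamma> t))) (at t within dom)"
proof -
  have g: "\<gamma> t \<in> chart_dom \<phi>" using assms(2) by (simp add: dom_def)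
  have x: "(coord \<phi> \<circ> \<gamma> has_derivative (\<lambda>r. r *\<^sub>R u t)) (at t within dom)"
    using has_velocity[OF assms(2)] by (simp add: has_vector_derivative_def)
  have "((f \<circ> coord_inv \<phi>) \<circ> (coord \<phi> \<circ> \<gamma>) has_derivative
      (\<lambda>v. \<Sum>a\<in>UNIV. v $ a * partial \<phi> a f (\<gamma> t)) \<circ> (\<lambda>r. r *\<^sub>R u t)) (at t within dom)"
    by (rule diff_chain_within[OF x]) (use smooth_in_has_derivative[OF assms(1) g] in
        \<open>simp add: has_derivative_at_withinI\<close>)
  then have "((\<lambda>s. f (\<gamma> s)) has_derivative
      (\<lambda>v. \<Sum>a\<in>UNIV. v $ a * partial \<phi> a f (\<gamma> t)) \<circ> (\<lambda>r. r *\<^sub>R u t)) (at t within dom)"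
    by (rule has_derivative_transform[OF assms(2), rotated]) (auto simp: dom_def coord_inv_coord)
  then show ?thesis
    unfolding has_field_derivative_def
    by (rule has_derivative_eq_rhs)
      (simp add: gradient_def inner_vec_def sum_distrib_left fun_eq_iff mult_ac)
qed

lemma along_curve_differentiable:
  fixes f :: "'m \<Rightarrow> real"
  assumes "smooth_in \<phi> f" "t \<in> dom"
  shows "(\<lambda>s. f (\<gamma> s)) differentiable (at t within dom)"
  using along_curve[OF assms] real_differentiable_def by blast

end

text \<open>Tangential terms and nonzero factors are absorbed into the factor of proportionality, so
  tangential parts of \<open>A\<close> never have to be computed.\<close>

lemma exists_proportional_iff:
  fixes a v :: "'a::real_vector"
  assumes "x \<noteq> 0" "r \<noteq> 0"
  shows "(\<exists>k. x *\<^sub>R a + y *\<^sub>R v = k *\<^sub>R r *\<^sub>R v) \<longleftrightarrow> (\<exists>k. a = k *\<^sub>R v)"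
proof
  assume "\<exists>k. x *\<^sub>R a + y *\<^sub>R v = k *\<^sub>R r *\<^sub>R v"
  then obtain k where "x *\<^sub>R a = (k * r - y) *\<^sub>R v"
    by (auto simp: algebra_simps)
  then have "inverse x *\<^sub>R x *\<^sub>R a = inverse x *\<^sub>R (k * r - y) *\<^sub>R v"
    by (simp only:)
  then show "\<exists>k. a = k *\<^sub>R v"
    using assms(1) by (auto simp: scaleR_scaleR)
next
  assume "\<exists>k. a = k *\<^sub>R v"
  then obtain k where "a = k *\<^sub>R v" ..
  then have "x *\<^sub>R a + y *\<^sub>R v = ((x * k + y) / r) *\<^sub>R r *\<^sub>R v"
    using assms(2) by (simp add: scaleR_add_left)
  then show "\<exists>k. x *\<^sub>R a + y *\<^sub>R v = k *\<^sub>R r *\<^sub>R v" ..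
qed

section \<open>Velocity, acceleration and squared speed for one metric\<close>

locale metric_curve = chart_metric \<A> \<phi> h + chart_curve \<A> \<phi> S \<gamma>
  for \<A> :: "('m::{second_countable_topology,t2_space}, 'n::finite) chart set" and \<phi> h S \<gamma>
begin

lemma entry_derivative:
  assumes "t \<in> dom"
  shows "((\<lambda>s. h \<phi> (\<gamma> s) $ a $ b) has_real_derivative metric_derivative h \<phi> (\<gamma> t) (u t) $ a $ b)
    (at t within dom)"
  using along_curve[OF smooth_entry assms, of a b]
  by (simp add: metric_derivative_def gradient_def inner_vec_def)

lemma lower_velocity_derivative:
  assumes "t \<in> dom"
  shows "((\<lambda>s. (h \<phi> (\<gamma> s) *v u s) $ a) has_real_derivative
    (metric_derivative h \<phi> (\<gamma> t) (u t) *v u t + h \<phi> (\<gamma> t) *v w t) $ a) (at t within dom)"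
  unfolding matrix_vector_mult_def vec_lambda_beta vector_add_component sum.distrib[symmetric]
  by (rule DERIV_sum DERIV_mult' entry_derivative velocity_derivative assms | simp add: mult_ac)+

lemma square_derivative:
  assumes "t \<in> dom"
  shows "(speed_sq h S \<gamma> \<phi> has_real_derivative 2 * (u t \<bullet> (h \<phi> (\<gamma> t) *v w t))
    + u t \<bullet> (metric_derivative h \<phi> (\<gamma> t) (u t) *v u t)) (at t within dom)"
proof -
  have "((\<lambda>s. \<Sum>a\<in>UNIV. u s $ a * (h \<phi> (\<gamma> s) *v u s) $ a) has_real_derivative
      (\<Sum>a\<in>UNIV. u t $ a * (metric_derivative h \<phi> (\<gamma> t) (u t) *v u t + h \<phi> (\<gamma> t) *v w t) $ a
        + w t $ a * (h \<phi> (\<gamma> t) *v u t) $ a)) (at t within dom)"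
    by (intro DERIV_sum DERIV_mult' lower_velocity_derivative velocity_derivative assms)
  moreover have "w t \<bullet> (h \<phi> (\<gamma> t) *v u t) = u t \<bullet> (h \<phi> (\<gamma> t) *v w t)"
    by (metis (no_types, lifting) assms dom_def dot_lmul_matrix inner_commute mem_Collect_eq symmetric
        vector_transpose_matrix)
  ultimately show ?thesis
    by (simp add: speed_sq_def[abs_def] inner_vec_def sum.distrib algebra_simps)
qed

lemma lower_acceleration:
  assumes "t \<in> dom"
  shows "h \<phi> (\<gamma> t) *v acceleration h S \<gamma> \<phi> t = h \<phi> (\<gamma> t) *v w t
    + metric_derivative h \<phi> (\<gamma> t) (u t) *v u t - (1/2) *\<^sub>R square_gradient h \<phi> (\<gamma> t) (u t)"
  using lower_christoffel_square[of "\<gamma> t" "u t"] assms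
  by (simp add: acceleration_def w_def Let_def dom_def matrix_vector_right_distrib)

text \<open>This is compatibility of the Levi-Civita connection with its metric, applied to the
  velocity.\<close>

lemma square_derivative_acceleration:
  assumes "t \<in> dom"
  shows "(speed_sq h S \<gamma> \<phi> has_real_derivative 2 * (u t \<bullet> (h \<phi> (\<gamma> t) *v acceleration h S \<gamma> \<phi> t)))
    (at t within dom)"
proof -
  \<comment> \<open>Both sides are the full contraction of the first derivatives of the metric with
    three copies of \<open>v\<close>.\<close>
  have "v \<bullet> square_gradient h \<phi> p v = v \<bullet> (metric_derivative h \<phi> p v *v v)" for p v
  proof -
    let ?d = "\<lambda>a b c. partial \<phi> a (\<lambda>q. h \<phi> q $ b $ c) p"
    have "v \<bullet> square_gradient h \<phi> p v = (\<Sum>b\<in>UNIV. \<Sum>a\<in>UNIV. \<Sum>c\<in>UNIV. v $ b * (v $ a * v $ c * ?d b a c))"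
      by (simp add: square_gradient_def inner_vec_def sum_distrib_left)
    also have "\<dots> = (\<Sum>a\<in>UNIV. \<Sum>b\<in>UNIV. \<Sum>c\<in>UNIV. v $ b * (v $ a * v $ c * ?d b a c))"
      by (rule sum.swap)
    also have "\<dots> = (\<Sum>a\<in>UNIV. \<Sum>c\<in>UNIV. \<Sum>b\<in>UNIV. v $ b * (v $ a * v $ c * ?d b a c))"
      by (intro sum.cong refl sum.swap)
    also have "\<dots> = v \<bullet> (metric_derivative h \<phi> p v *v v)"
      by (simp add: metric_derivative_def inner_vec_def matrix_vector_mult_def sum_distrib_left mult_ac)
    finally show ?thesis .
  qed
  then show ?thesis
    using square_derivative[OF assms]
    by (simp add: lower_acceleration[OF assms] inner_add_right inner_diff_right algebra_simps)
qed

end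

section \<open>Tractors along a curve\<close>

locale scaled_curve = chart_scale \<A> \<phi> G h \<tau> + chart_curve \<A> \<phi> S \<gamma>
  for \<A> :: "('m::{second_countable_topology,t2_space}, 'n::finite) chart set" and \<phi> G h \<tau> S \<gamma> +
  assumes nonnull: "t \<in> dom \<Longrightarrow> speed_sq G S \<gamma> \<phi> t \<noteq> 0"

sublocale scaled_curve \<subseteq> GC: metric_curve \<A> \<phi> G S \<gamma> ..
sublocale scaled_curve \<subseteq> HC: metric_curve \<A> \<phi> h S \<gamma> ..

context scaled_curve
begin

abbreviation q :: "real \<Rightarrow> real" where "q \<equiv> speed_sq G S \<gamma> \<phi>"

definition r :: "real \<Rightarrow> real" where "r t = inverse (speed G S \<gamma> \<phi> t)"

definition q' :: "real \<Rightarrow> real" where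
  "q' t = 2 * (u t \<bullet> (G \<phi> (\<gamma> t) *v w t)) + u t \<bullet> (metric_derivative G \<phi> (\<gamma> t) (u t) *v u t)"

definition r' :: "real \<Rightarrow> real" where "r' t = - (r t * q' t / (2 * q t))"

text \<open>The connection form of 1-densities for \<open>h\<close> evaluated on the velocity, as
  \<open>theta_eq\<close> confirms.\<close>

definition \<theta> :: "real \<Rightarrow> real" where "\<theta> t = - ((u t \<bullet> gradient \<phi> \<tau> (\<gamma> t)) / \<tau> (\<gamma> t))"

text \<open>The bottom slot of \<open>U\<close>: the derivative of \<open>r\<close> along the curve
  as a density of weight -1, whence the sign of \<open>\<theta>\<close>.\<close>

definition \<psi> :: "real \<Rightarrow> real" where "\<psi> t = r' t - \<theta> t * r t"

lemma r_nonzero: "t \<in> dom \<Longrightarrow> r t \<noteq> 0"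
  using nonnull by (simp add: r_def speed_def)

lemma in_chart: "t \<in> dom \<Longrightarrow> \<gamma> t \<in> chart_dom \<phi>"
  by (simp add: dom_def)

lemma theta_eq: "t \<in> dom \<Longrightarrow> u t \<bullet> density_form 1 h \<phi> (\<gamma> t) = \<theta> t"
  by (simp add: density_form_scale in_chart \<theta>_def)

lemma q_derivative: "t \<in> dom \<Longrightarrow> (q has_real_derivative q' t) (at t within dom)"
  unfolding q'_def by (rule GC.square_derivative)

lemma r_derivative:
  assumes "t \<in> dom"
  shows "(r has_real_derivative r' t) (at t within dom)"
  using has_real_derivative_inverse_sqrt_abs[OF q_derivative[OF assms] nonnull[OF assms]]
  by (simp add: r_def[abs_def] r'_def speed_def[abs_def])

text \<open>
  Without this the vector derivative of the triple \<open>U\<close>, and with it \<open>A\<close>, would be a junk value.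
\<close>

lemma psi_differentiable:
  assumes "t \<in> dom"
  shows "\<psi> differentiable (at t within dom)"
proof -
  have u: "(\<lambda>s. u s $ a) differentiable (at t within dom)" for a
    using velocity_derivative[OF assms] real_differentiable_def by blast
  have r: "r differentiable (at t within dom)"
    using r_derivative[OF assms] real_differentiable_def by blast
  have q: "q differentiable (at t within dom)"
    using q_derivative[OF assms] real_differentiable_def by blast
  have q': "q' differentiable (at t within dom)"
    unfolding q'_def[abs_def] inner_vec_def matrix_vector_mult_def metric_derivative_def inner_real_def
      vec_lambda_beta
    by (intro differentiable_add differentiable_mult differentiable_sum ballI u w_differentiable
        differentiable_const along_curve_differentiable G.smooth_entry G.smooth_in_partial assms finite)
  have "\<tau> (\<gamma> t) \<noteq> 0"
    using scale_pos[OF in_chart[OF assms]] by simp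
  then have th: "\<theta> differentiable (at t within dom)"
    unfolding \<theta>_def[abs_def] inner_vec_def gradient_def inner_real_def vec_lambda_beta
    by (intro differentiable_minus differentiable_divide differentiable_mult differentiable_sum u
        along_curve_differentiable smooth_scale G.smooth_in_partial assms finite ballI)
  show ?thesis
    unfolding \<psi>_def[abs_def] r'_def[abs_def]
    by (intro differentiable_diff differentiable_minus differentiable_divide differentiable_mult
        differentiable_const r q q' th) (use nonnull[OF assms] in simp)
qed

text \<open>Only the bottom slot of the rescaled \<open>X\<close> is nonzero. The metric term of the
  tractor connection moves it into the middle slot, and no curvature appears.\<close>

lemma U_tractor_eq:
  assumes "t \<in> dom"
  shows "U_tractor G S \<gamma> \<phi> h t = (0, r t *\<^sub>R (G \<phi> (\<gamma> t) *v u t), \<psi> t)"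
proof -
  have "((\<lambda>s. inverse (speed G S \<gamma> \<phi> s) *\<^sub>R X_tractor \<phi> h) has_vector_derivative (0, 0, r' t)) (at t within S)"
    unfolding X_tractor_def scaleR_Pair at_dom[OF assms] r_def[symmetric]
    using r_derivative[OF assms]
    by (intro has_vector_derivative_Pair) (simp_all add: has_real_derivative_iff_has_vector_derivative)
  then have "vector_derivative (\<lambda>s. inverse (speed G S \<gamma> \<phi> s) *\<^sub>R X_tractor \<phi> h) (at t within S) = (0, 0, r' t)"
    using vector_derivative_within[OF at_dom_nontrivial[OF assms]] at_dom[OF assms] by metis
  then have "tractor_deriv G S \<gamma> \<phi> h (\<lambda>s. inverse (speed G S \<gamma> \<phi> s) *\<^sub>R X_tractor \<phi> h) t =
      (0, r t *\<^sub>R (G \<phi> (\<gamma> t) *v u t), \<psi> t)"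
    unfolding tractor_deriv_def Let_def theta_eq[OF assms]
    by (simp add: X_tractor_def r_def \<psi>_def flip: zero_vec_def)
  then show ?thesis
    using r_nonzero[OF assms] unfolding U_tractor_def weighted_tractor_deriv_def by (simp add: r_def)
qed

text \<open>The Euler-Lagrange expression of the energy \<open>1/2 G(u, u)\<close> in coordinates.
  It depends on \<open>G\<close> alone, so it is common to all scales and allows two of them to be
  compared.\<close>

definition force :: "real \<Rightarrow> real^'n" where
  "force t = G \<phi> (\<gamma> t) *v w t + metric_derivative G \<phi> (\<gamma> t) (u t) *v u t
     - (1/2) *\<^sub>R square_gradient G \<phi> (\<gamma> t) (u t)"

text \<open>The top slot of \<open>U\<close> is zero, so the Schouten tensor reaches only the bottom
  slot of \<open>A\<close>. That slot and the tangential coefficient stay unspecified because the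
  wedge with \<open>X\<close> and \<open>U\<close> does not see them.\<close>

lemma A_tractor_eq:
  assumes "t \<in> dom"
  obtains k \<rho> where "A_tractor G S \<gamma> \<phi> h t = (- (r t * q t),
    r t *\<^sub>R (force t + (q t / \<tau> (\<gamma> t)) *\<^sub>R gradient \<phi> \<tau> (\<gamma> t)) + k *\<^sub>R (G \<phi> (\<gamma> t) *v u t), \<rho>)"
proof -
  let ?p = "\<gamma> t" and ?Gu = "\<lambda>t. G \<phi> (\<gamma> t) *v u t"
  let ?Gu' = "metric_derivative G \<phi> (\<gamma> t) (u t) *v u t + G \<phi> (\<gamma> t) *v w t"
  obtain \<psi>' where psi': "(\<psi> has_real_derivative \<psi>') (at t within dom)"
    using psi_differentiable[OF assms] real_differentiable_def by blast
  have "((\<lambda>s. r s *\<^sub>R ?Gu s) has_vector_derivative r t *\<^sub>R ?Gu' + r' t *\<^sub>R ?Gu t) (at t within dom)"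
    by (rule has_vector_derivative_scaleR[OF r_derivative[OF assms]])
      (use GC.lower_velocity_derivative[OF assms] in \<open>simp add: has_vector_derivative_vec_iff\<close>)
  then have "((\<lambda>s. (0::real, r s *\<^sub>R ?Gu s, \<psi> s)) has_vector_derivative
      (0, r t *\<^sub>R ?Gu' + r' t *\<^sub>R ?Gu t, \<psi>')) (at t within dom)"
    using psi' by (intro has_vector_derivative_Pair has_vector_derivative_const)
      (simp_all add: has_real_derivative_iff_has_vector_derivative)
  \<comment> \<open>The closed form of \<open>U\<close> holds only on \<open>dom\<close>, which is
    why the derivative is taken within \<open>dom\<close> and compared with the one within
    \<open>S\<close> afterwards.\<close>
  then have "(U_tractor G S \<gamma> \<phi> h has_vector_derivative (0, r t *\<^sub>R ?Gu' + r' t *\<^sub>R ?Gu t, \<psi>')) (at t within dom)"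
    by (rule has_vector_derivative_transform[OF assms, rotated]) (simp add: U_tractor_eq)
  then have d: "vector_derivative (U_tractor G S \<gamma> \<phi> h) (at t within S) = (0, r t *\<^sub>R ?Gu' + r' t *\<^sub>R ?Gu t, \<psi>')"
    using vector_derivative_within[OF at_dom_nontrivial[OF assms]] at_dom[OF assms] by metis
  have c: "(\<chi> b. \<Sum>a\<in>UNIV. \<Sum>c\<in>UNIV. christoffel h \<phi> ?p c a b * u t $ a * (r t *\<^sub>R ?Gu t) $ c) =
      r t *\<^sub>R ((1/2) *\<^sub>R square_gradient G \<phi> ?p (u t) - (q t / \<tau> ?p) *\<^sub>R gradient \<phi> \<tau> ?p)"
    unfolding speed_sq_def christoffel_lower_scale[OF in_chart[OF assms], symmetric]
    by (simp add: vec_eq_iff sum_distrib_left mult_ac)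
  have A: "A_tractor G S \<gamma> \<phi> h t = tractor_deriv G S \<gamma> \<phi> h (U_tractor G S \<gamma> \<phi> h) t"
    using r_nonzero[OF assms] unfolding A_tractor_def weighted_tractor_deriv_def by (simp add: r_def)
  have s: "u t \<bullet> (r t *\<^sub>R ?Gu t) = r t * q t"
    by (simp add: speed_sq_def)
  obtain \<rho> where "A_tractor G S \<gamma> \<phi> h t = (- (r t * q t),
      (r t *\<^sub>R ?Gu' + r' t *\<^sub>R ?Gu t) - r t *\<^sub>R ((1/2) *\<^sub>R square_gradient G \<phi> ?p (u t) - (q t / \<tau> ?p) *\<^sub>R gradient \<phi> \<tau> ?p)
      + \<theta> t *\<^sub>R r t *\<^sub>R ?Gu t + \<psi> t *\<^sub>R ?Gu t, \<rho>)"
    unfolding A tractor_deriv_def Let_def d U_tractor_eq[OF assms] theta_eq[OF assms] prod.case c s by simp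
  moreover have "(r t *\<^sub>R ?Gu' + r' t *\<^sub>R ?Gu t) - r t *\<^sub>R ((1/2) *\<^sub>R square_gradient G \<phi> ?p (u t) - (q t / \<tau> ?p) *\<^sub>R gradient \<phi> \<tau> ?p)
      + \<theta> t *\<^sub>R r t *\<^sub>R ?Gu t + \<psi> t *\<^sub>R ?Gu t =
      r t *\<^sub>R (force t + (q t / \<tau> ?p) *\<^sub>R gradient \<phi> \<tau> ?p) + (r' t + \<theta> t * r t + \<psi> t) *\<^sub>R ?Gu t"
    unfolding force_def by (simp add: algebra_simps)
  ultimately show thesis
    using that by metis
qed

text \<open>Apart from \<open>force\<close>, the scale contributes only terms in the gradient of
  \<open>\<tau>\<close>, and the last of these is tangential.\<close>

lemma lower_acceleration_scale:
  assumes "t \<in> dom"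
  shows "G \<phi> (\<gamma> t) *v acceleration h S \<gamma> \<phi> t = force t + (q t / \<tau> (\<gamma> t)) *\<^sub>R gradient \<phi> \<tau> (\<gamma> t)
    - (2 * (u t \<bullet> gradient \<phi> \<tau> (\<gamma> t)) / \<tau> (\<gamma> t)) *\<^sub>R (G \<phi> (\<gamma> t) *v u t)"
  using lower_christoffel_scale[OF in_chart[OF assms], of "u t"]
  by (simp add: acceleration_def w_def[symmetric] Let_def matrix_vector_right_distrib force_def speed_sq_def)

end

text \<open>The middle slot is the covariant derivative of \<open>\<sigma>\<close> in the scale
  \<open>h\<close>. The bottom slot, with second derivatives and curvature, is a multiple of
  \<open>X\<close> and stays unnamed.\<close>

lemma scale_tractor_eq:
  assumes "scaled_curve \<A> \<phi> G h \<tau> S \<gamma>" "p \<in> chart_dom \<phi>"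
  obtains \<rho> where "scale_tractor G \<sigma> \<phi> h p =
    (\<sigma> \<phi> p, gradient \<phi> (\<sigma> \<phi>) p - (\<sigma> \<phi> p / \<tau> p) *\<^sub>R gradient \<phi> \<tau> p, \<rho>)"
proof -
  interpret scaled_curve \<A> \<phi> G h \<tau> S \<gamma> by fact
  have "nabla_density 1 h \<phi> (\<sigma> \<phi>) p = gradient \<phi> (\<sigma> \<phi>) p - (\<sigma> \<phi> p / \<tau> p) *\<^sub>R gradient \<phi> \<tau> p"
    by (simp add: nabla_density_def density_form_scale[OF assms(2)] gradient_def vec_eq_iff)
  then show thesis
    using that by (simp add: scale_tractor_def)
qed

text \<open>Two scales over the same \<open>G\<close> are in play: the tractors are computed in
  \<open>h\<close>, the acceleration belongs to \<open>g\<close>. The common \<open>force\<close>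
  links them.\<close>

lemma wedge_zero_iff:
  assumes "scaled_curve \<A> \<phi> G h \<tau> S \<gamma>" "scaled_curve \<A> \<phi> G g (\<sigma> \<phi>) S \<gamma>"
    and t: "t \<in> S" "\<gamma> t \<in> chart_dom \<phi>"
  shows "(\<forall>J. I_wedge_Sigma G \<sigma> S \<gamma> \<phi> h t J = 0) \<longleftrightarrow>
    (\<exists>k. acceleration g S \<gamma> \<phi> t = k *\<^sub>R velocity S \<gamma> \<phi> t)"
proof -
  interpret scaled_curve \<A> \<phi> G h \<tau> S \<gamma> by fact
  interpret g: scaled_curve \<A> \<phi> G g "\<sigma> \<phi>" S \<gamma> by fact
  have t': "t \<in> dom" using t by (simp add: dom_def)
  let ?p = "\<gamma> t"
  let ?Gi = "matrix_inv (G \<phi> ?p)" and ?Gu = "G \<phi> ?p *v u t" and ?a = "acceleration g S \<gamma> \<phi> t"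
  have s: "\<sigma> \<phi> ?p \<noteq> 0" using g.scale_pos[OF t(2)] by simp
  have inv: "?Gi *v (G \<phi> ?p *v v) = v" for v
    using matrix_inv_mult(2)[OF G.invertible[OF t(2)]] by (simp add: matrix_vector_mul_assoc)
  obtain k \<rho> where A: "A_tractor G S \<gamma> \<phi> h t = (- (r t * q t),
      r t *\<^sub>R (force t + (q t / \<tau> ?p) *\<^sub>R gradient \<phi> \<tau> ?p) + k *\<^sub>R ?Gu, \<rho>)"
    using A_tractor_eq[OF t'] .
  obtain \<iota> where I: "scale_tractor G \<sigma> \<phi> h ?p =
      (\<sigma> \<phi> ?p, gradient \<phi> (\<sigma> \<phi>) ?p - (\<sigma> \<phi> ?p / \<tau> ?p) *\<^sub>R gradient \<phi> \<tau> ?p, \<iota>)"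
    using scale_tractor_eq[OF assms(1) t(2)] .
  let ?U = "?Gi *v (r t *\<^sub>R ?Gu)"
  let ?A = "?Gi *v (r t *\<^sub>R (force t + (q t / \<tau> ?p) *\<^sub>R gradient \<phi> \<tau> ?p) + k *\<^sub>R ?Gu)"
  let ?I = "?Gi *v (gradient \<phi> (\<sigma> \<phi>) ?p - (\<sigma> \<phi> ?p / \<tau> ?p) *\<^sub>R gradient \<phi> \<tau> ?p)"
  have U: "?U = r t *\<^sub>R u t"
    by (simp add: matrix_vector_mult_scaleR inv)
  have "(\<forall>J. I_wedge_Sigma G \<sigma> S \<gamma> \<phi> h t J = 0) \<longleftrightarrow>
      (\<exists>k. \<sigma> \<phi> ?p *\<^sub>R ?A - (- (r t * q t)) *\<^sub>R ?I = k *\<^sub>R ?U)"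
    unfolding I_wedge_Sigma_def three_tractor_def
    by (rule alternating_wedge_zero_iff)
      (use r_nonzero[OF t'] nonnull[OF t'] velocity_nonzero[OF t'] in
        \<open>simp_all add: tractor_comp_def X_tractor_def U_tractor_eq[OF t'] A I U[simplified] flip: r_def\<close>)
  also have "\<sigma> \<phi> ?p *\<^sub>R ?A - (- (r t * q t)) *\<^sub>R ?I =
      (r t * \<sigma> \<phi> ?p) *\<^sub>R ?a + (\<sigma> \<phi> ?p * k + 2 * r t * (u t \<bullet> gradient \<phi> (\<sigma> \<phi>) ?p)) *\<^sub>R u t"
  proof -
    let ?F = "force t" and ?\<tau> = "\<tau> ?p" and ?\<sigma> = "\<sigma> \<phi> ?p" and ?d\<tau> = "gradient \<phi> \<tau> ?p" and ?d\<sigma> = "gradient \<phi> (\<sigma> \<phi>) ?p"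
    \<comment> \<open>The acceleration formula for \<open>g\<close>, solved for the common
      \<open>force\<close>.\<close>
    have F: "?F = G \<phi> ?p *v ?a - (q t / ?\<sigma>) *\<^sub>R ?d\<sigma> + (2 * (u t \<bullet> ?d\<sigma>) / ?\<sigma>) *\<^sub>R ?Gu"
      using g.lower_acceleration_scale[OF t'] by (simp add: g.force_def force_def)
    \<comment> \<open>With lowered indices, the \<open>\<tau>\<close>-terms of \<open>A\<close> and
      \<open>I\<close> cancel, and the term from \<open>F\<close> in the gradient of
      \<open>\<sigma>\<close> cancels the one from \<open>I\<close>.\<close>
    have "?\<sigma> *\<^sub>R (r t *\<^sub>R (?F + (q t / ?\<tau>) *\<^sub>R ?d\<tau>) + k *\<^sub>R ?Gu)
        - (- (r t * q t)) *\<^sub>R (?d\<sigma> - (?\<sigma> / ?\<tau>) *\<^sub>R ?d\<tau>) =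
        (r t * ?\<sigma>) *\<^sub>R (G \<phi> ?p *v ?a) + (?\<sigma> * k + 2 * r t * (u t \<bullet> ?d\<sigma>)) *\<^sub>R ?Gu"
      unfolding F using s by (simp add: vec_eq_iff field_simps)
    from arg_cong[OF this, of "(*v) ?Gi"] show ?thesis
      by (simp only: matrix_vector_mult_diff_distrib matrix_vector_right_distrib matrix_vector_mult_scaleR inv)
  qed
  finally show ?thesis
    unfolding U using exists_proportional_iff[of "r t * \<sigma> \<phi> ?p" "r t"] s r_nonzero[OF t'] by simp
qed

section \<open>Change of charts\<close>

lemma open_coord_overlap:
  assumes "manifold_chart \<A> \<phi>" "manifold_chart \<A> \<psi>"
  shows "open (coord \<phi> ` (chart_dom \<phi> \<inter> chart_dom \<psi>))"
proof -
  interpret \<phi>: manifold_chart \<A> \<phi> by fact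
  interpret \<psi>: manifold_chart \<A> \<psi> by fact
  have "openin (top_of_set (coord \<phi> ` chart_dom \<phi>)) (coord \<phi> ` (chart_dom \<phi> \<inter> chart_dom \<psi>))"
    using homeomorphism_imp_open_map[OF \<phi>.homeo] \<psi>.open_dom by (simp add: openin_open_Int)
  then show ?thesis
    using \<phi>.open_im openin_open_trans by metis
qed

lemma jac_has_derivative:
  assumes "manifold_chart \<A> \<phi>" "manifold_chart \<A> \<psi>" "p \<in> chart_dom \<phi> \<inter> chart_dom \<psi>"
  shows "(coord \<psi> \<circ> coord_inv \<phi> has_derivative (\<lambda>v. jac \<phi> \<psi> p *v v)) (at (coord \<phi> p))"
proof -
  have "smooth_on (coord \<phi> ` (chart_dom \<phi> \<inter> chart_dom \<psi>)) (coord \<psi> \<circ> coord_inv \<phi>)"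
    using assms(1,2) by (simp add: manifold_chart_def smooth_manifold_def)
  then have "(coord \<psi> \<circ> coord_inv \<phi>) differentiable (at (coord \<phi> p))"
    by (rule smooth_on_differentiable[OF _ open_coord_overlap[OF assms(1,2)]]) (use assms(3) in blast)
  then have d: "(coord \<psi> \<circ> coord_inv \<phi> has_derivative
      frechet_derivative (coord \<psi> \<circ> coord_inv \<phi>) (at (coord \<phi> p))) (at (coord \<phi> p))"
    by (simp add: frechet_derivative_works)
  show ?thesis
    unfolding jac_def using d matrix_vector_mul(2)[OF has_derivative_linear[OF d]] by (simp only:)
qed

text \<open>Both chart parts of the curve are relatively open in \<open>S\<close>, so derivatives
  computed in either chart can be compared on the overlap.\<close>

lemma at_within_overlap:
  assumes "chart_curve \<A> \<phi> S \<gamma>" "chart_curve \<A> \<psi> S \<gamma>"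
    and "t \<in> chart_curve.dom \<phi> S \<gamma>" "t \<in> chart_curve.dom \<psi> S \<gamma>"
  shows "at t within (chart_curve.dom \<phi> S \<gamma> \<inter> chart_curve.dom \<psi> S \<gamma>) = at t within S"
proof -
  interpret \<phi>: chart_curve \<A> \<phi> S \<gamma> by fact
  interpret \<psi>: chart_curve \<A> \<psi> S \<gamma> by fact
  obtain O1 O2 where "open O1" "\<phi>.dom = S \<inter> O1" "open O2" "\<psi>.dom = S \<inter> O2"
    using \<phi>.dom_relatively_open \<psi>.dom_relatively_open by metis
  then show ?thesis
    using assms(3,4) by (intro at_within_nhd[of t "O1 \<inter> O2"]) auto
qed

lemma velocity_chart_change:
  assumes "chart_curve \<A> \<phi> S \<gamma>" "chart_curve \<A> \<psi> S \<gamma>"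
    and "t \<in> chart_curve.dom \<phi> S \<gamma>" "t \<in> chart_curve.dom \<psi> S \<gamma>"
  shows "velocity S \<gamma> \<psi> t = jac \<phi> \<psi> (\<gamma> t) *v velocity S \<gamma> \<phi> t"
proof -
  interpret \<phi>: chart_curve \<A> \<phi> S \<gamma> by fact
  interpret \<psi>: chart_curve \<A> \<psi> S \<gamma> by fact
  let ?D = "\<phi>.dom \<inter> \<psi>.dom"
  have p: "\<gamma> t \<in> chart_dom \<phi> \<inter> chart_dom \<psi>"
    using assms(3,4) by (simp add: \<phi>.dom_def \<psi>.dom_def)
  note J = jac_has_derivative[OF \<phi>.manifold_chart_axioms \<psi>.manifold_chart_axioms p]
  have "(coord \<phi> \<circ> \<gamma> has_derivative (\<lambda>r. r *\<^sub>R \<phi>.u t)) (at t within ?D)"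
    using has_vector_derivative_within_subset[OF \<phi>.has_velocity[OF assms(3)], of ?D]
    by (simp add: has_vector_derivative_def)
  then have "((coord \<psi> \<circ> coord_inv \<phi>) \<circ> (coord \<phi> \<circ> \<gamma>) has_derivative
      (\<lambda>v. jac \<phi> \<psi> (\<gamma> t) *v v) \<circ> (\<lambda>r. r *\<^sub>R \<phi>.u t)) (at t within ?D)"
    by (rule diff_chain_within) (use J in \<open>simp add: has_derivative_at_withinI\<close>)
  then have "((coord \<psi> \<circ> coord_inv \<phi>) \<circ> (coord \<phi> \<circ> \<gamma>) has_vector_derivative
      jac \<phi> \<psi> (\<gamma> t) *v \<phi>.u t) (at t within ?D)"
    unfolding has_vector_derivative_def by (simp add: o_def matrix_vector_mult_scaleR)
  then have "(coord \<psi> \<circ> \<gamma> has_vector_derivative jac \<phi> \<psi> (\<gamma> t) *v \<phi>.u t) (at t within ?D)"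
    by (rule has_vector_derivative_transform[rotated 2])
      (use assms(3,4) in \<open>auto simp: \<phi>.coord_inv_coord \<phi>.dom_def\<close>)
  moreover have "(coord \<psi> \<circ> \<gamma> has_vector_derivative \<psi>.u t) (at t within ?D)"
    by (rule has_vector_derivative_within_subset[OF \<psi>.has_velocity[OF assms(4)]]) simp
  moreover have "at t within ?D \<noteq> bot"
    using at_within_overlap[OF assms] \<phi>.at_dom \<phi>.at_dom_nontrivial assms(3) by metis
  ultimately show ?thesis
    using vector_derivative_unique_within by blast
qed

text \<open>The Jacobians of the velocity and of the form cancel, so the squared length is a scalar
  function of the parameter.\<close>

lemma speed_sq_chart_change:
  assumes "chart_curve \<A> \<phi> S \<gamma>" "chart_curve \<A> \<psi> S \<gamma>" "symmetric_form \<A> 0 g"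
    and "t \<in> chart_curve.dom \<phi> S \<gamma>" "t \<in> chart_curve.dom \<psi> S \<gamma>"
  shows "speed_sq g S \<gamma> \<psi> t = speed_sq g S \<gamma> \<phi> t"
proof -
  interpret \<phi>: chart_curve \<A> \<phi> S \<gamma> by fact
  interpret \<psi>: chart_curve \<A> \<psi> S \<gamma> by fact
  let ?J = "jac \<phi> \<psi> (\<gamma> t)"
  have p: "\<gamma> t \<in> chart_dom \<phi> \<inter> chart_dom \<psi>"
    using assms(4,5) by (simp add: \<phi>.dom_def \<psi>.dom_def)
  \<comment> \<open>In \<open>powr\<close> the exponent 0 gives 1 only for a nonzero base, so the
    Jacobian determinant must be nonzero here.\<close>
  have "weight_factor 0 \<phi> \<psi> (\<gamma> t) = 1"
    using det_jac_nonzero[OF \<phi>.manifold \<phi>.chart \<psi>.chart p] by (simp add: weight_factor_def)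
  then have g: "transpose ?J ** g \<psi> (\<gamma> t) ** ?J = g \<phi> (\<gamma> t)"
    using assms(3) p \<phi>.chart \<psi>.chart by (simp add: symmetric_form_def)
  have "(?J *v v) \<bullet> (g \<psi> (\<gamma> t) *v (?J *v v)) = v \<bullet> ((transpose ?J ** g \<psi> (\<gamma> t) ** ?J) *v v)" for v
  proof -
    have "v \<bullet> (transpose ?J *v x) = (?J *v v) \<bullet> x" for x
      by (metis dot_lmul_matrix vector_transpose_matrix)
    then show ?thesis
      by (simp flip: matrix_vector_mul_assoc)
  qed
  then show ?thesis
    unfolding speed_sq_def velocity_chart_change[OF assms(1,2,4,5)] g by simp
qed

text \<open>This takes the place of a transformation law for the acceleration: a geodesic needs one
  factor for all charts, and the derivative of a chart-independent scalar determines it.\<close>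

lemma geodesic_factor_unique:
  assumes "metric_curve \<A> \<phi> g S \<gamma>" "metric_curve \<A> \<psi> g S \<gamma>" "symmetric_form \<A> 0 g"
    and t: "t \<in> S" "\<gamma> t \<in> chart_dom \<phi>" "\<gamma> t \<in> chart_dom \<psi>"
    and nonnull: "speed_sq g S \<gamma> \<phi> t \<noteq> 0"
    and acc: "acceleration g S \<gamma> \<phi> t = k *\<^sub>R velocity S \<gamma> \<phi> t"
      "acceleration g S \<gamma> \<psi> t = l *\<^sub>R velocity S \<gamma> \<psi> t"
  shows "k = l"
proof -
  interpret \<phi>: metric_curve \<A> \<phi> g S \<gamma> by fact
  interpret \<psi>: metric_curve \<A> \<psi> g S \<gamma> by fact
  have t': "t \<in> \<phi>.dom" "t \<in> \<psi>.dom"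
    using t by (auto simp: \<phi>.dom_def \<psi>.dom_def)
  let ?D = "\<phi>.dom \<inter> \<psi>.dom" and ?f = "speed_sq g S \<gamma> \<phi>"
  note cc = \<phi>.chart_curve_axioms \<psi>.chart_curve_axioms
  have "(?f has_real_derivative 2 * k * ?f t) (at t within ?D)"
    using DERIV_subset[OF \<phi>.square_derivative_acceleration[OF t'(1)], of ?D]
    by (simp add: acc speed_sq_def matrix_vector_mult_scaleR mult.assoc)
  moreover have "(speed_sq g S \<gamma> \<psi> has_real_derivative 2 * l * speed_sq g S \<gamma> \<psi> t) (at t within ?D)"
    using DERIV_subset[OF \<psi>.square_derivative_acceleration[OF t'(2)], of ?D]
    by (simp add: acc speed_sq_def matrix_vector_mult_scaleR mult.assoc)
  \<comment> \<open>The squared speeds in the two charts agree on the overlap, so the second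
    derivative also belongs to the first function.\<close>
  then have "(?f has_real_derivative 2 * l * ?f t) (at t within ?D)"
    unfolding has_field_derivative_def
      speed_sq_chart_change[OF cc assms(3) t']
    by (rule has_derivative_transform[rotated 2])
      (use t' speed_sq_chart_change[OF cc assms(3)] in auto)
  moreover have "at t within ?D \<noteq> bot"
    using at_within_overlap[OF cc t'] \<phi>.at_dom \<phi>.at_dom_nontrivial t'(1) by metis
  ultimately have "2 * k * ?f t = 2 * l * ?f t"
    by (rule has_field_derivative_unique)
  then show ?thesis
    using nonnull by simp
qed

section \<open>From the global hypotheses to each chart, and the theorem\<close>

lemma chart_metricI:
  assumes "smooth_manifold \<A>" "\<phi> \<in> \<A>" "symmetric_form \<A> v h"
    and "\<And>p. p \<in> chart_dom \<phi> \<Longrightarrow> invertible (h \<phi> p)"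
  shows "chart_metric \<A> \<phi> h"
proof (intro chart_metric.intro manifold_chart.intro chart_metric_axioms.intro)
  show "smooth_in \<phi> (h \<phi>)" "\<And>p. p \<in> chart_dom \<phi> \<Longrightarrow> Finite_Cartesian_Product.transpose (h \<phi> p) = h \<phi> p"
    using assms(2,3) by (simp_all add: symmetric_form_def)
qed (use assms in simp_all)

lemma scaled_curveI:
  assumes "smooth_manifold \<A>" "pseudo_riemannian_metric \<A> h" "conformal_metric \<A> c G"
    and "scale_of \<A> G h \<tau>" "smooth_regular_curve \<A> S \<gamma>" "nowhere_null \<A> G S \<gamma>" "\<phi> \<in> \<A>"
  shows "scaled_curve \<A> \<phi> G h (\<tau> \<phi>) S \<gamma>"
proof -
  have det: "\<bar>det (G \<phi> p)\<bar> = 1" if "p \<in> chart_dom \<phi>" for p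
    using assms(3,7) that by (simp add: conformal_metric_def)
  have cc: "chart_curve \<A> \<phi> S \<gamma>"
    by (intro chart_curve.intro manifold_chart.intro chart_curve_axioms.intro assms)
  have "chart_metric \<A> \<phi> G"
  proof (rule chart_metricI[OF assms(1,7)])
    show "symmetric_form \<A> 2 G"
      using assms(3) by (simp add: conformal_metric_def)
    show "invertible (G \<phi> p)" if "p \<in> chart_dom \<phi>" for p
      using det[OF that] by (auto simp: invertible_det_nz)
  qed
  moreover have "chart_metric \<A> \<phi> h"
  proof (rule chart_metricI[OF assms(1,7)])
    show "symmetric_form \<A> 0 h" "\<And>p. p \<in> chart_dom \<phi> \<Longrightarrow> invertible (h \<phi> p)"
      using assms(2,7) by (simp_all add: pseudo_riemannian_metric_def)
  qed
  moreover have "chart_scale_axioms \<phi> G h (\<tau> \<phi>)"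
  proof (rule chart_scale_axioms.intro)
    show "smooth_in \<phi> (\<tau> \<phi>)"
      using assms(4,7) unfolding scale_of_def positive_density_def density_def by blast
  qed (use assms(4,7) det in \<open>auto simp: scale_of_def positive_density_def\<close>)
  moreover have "scaled_curve_axioms \<phi> G S \<gamma>"
    using assms(6,7) by (simp add: scaled_curve_axioms_def chart_curve.dom_def[OF cc] nowhere_null_def)
  ultimately show ?thesis
    using cc by (intro scaled_curve.intro chart_scale.intro)
qed

text \<open>The wedge condition ranges over the metrics of the class; membership of \<open>g\<close>
  provides a scale in which it can be evaluated.\<close>

lemma mem_conformal_class_self:
  assumes "smooth_manifold \<A>" "pseudo_riemannian_metric \<A> g"
  shows "g \<in> conformal_class \<A> g"
proof -
  have "smooth_in \<phi> (\<lambda>q. 0 :: real)" if "\<phi> \<in> \<A>" for \<phi>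
    using manifold_chart.smooth_in_const[of \<A> \<phi> "0 :: real"] assms(1) that by (simp add: manifold_chart_def)
  then have "conformal_change \<A> (\<lambda>q. 0) g g"
    by (simp add: conformal_change_def)
  then show ?thesis
    using assms(2) by (auto simp: conformal_class_def)
qed

theorem theorem2:
  fixes \<A> :: "('m::{second_countable_topology,t2_space}, 'n::finite) chart set"
    and g G :: "('m, 'n) form_field"
    and c :: "('m, 'n) form_field set"
    and \<sigma> :: "('m, 'n) scalar_field"
    and S :: "real set"
    and \<gamma> :: "real \<Rightarrow> 'm"
  assumes "CARD('n) \<ge> 3"
    and "smooth_manifold \<A>"
    and "pseudo_riemannian_metric \<A> g"
    and "c = conformal_class \<A> g"
    and "conformal_metric \<A> c G"
    and "scale_of \<A> G g \<sigma>"
    and "smooth_regular_curve \<A> S \<gamma>"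
    and "nowhere_null \<A> G S \<gamma>"
  shows "unparametrised_geodesic \<A> g S \<gamma> \<longleftrightarrow>
    (\<forall>t\<in>S. \<forall>\<phi>\<in>\<A>. \<gamma> t \<in> chart_dom \<phi> \<longrightarrow>
       (\<forall>h\<in>c. \<forall>J. I_wedge_Sigma G \<sigma> S \<gamma> \<phi> h t J = 0))"
proof -
  have sg: "scaled_curve \<A> \<phi> G g (\<sigma> \<phi>) S \<gamma>" if "\<phi> \<in> \<A>" for \<phi>
    by (rule scaled_curveI[OF assms(2,3,5,6,7,8) that])
  have wedge: "(\<forall>J. I_wedge_Sigma G \<sigma> S \<gamma> \<phi> h t J = 0) \<longleftrightarrow>
      (\<exists>k. acceleration g S \<gamma> \<phi> t = k *\<^sub>R velocity S \<gamma> \<phi> t)"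
    if "\<phi> \<in> \<A>" "h \<in> c" "t \<in> S" "\<gamma> t \<in> chart_dom \<phi>" for \<phi> h t
  proof -
    obtain \<tau> where \<tau>: "scale_of \<A> G h \<tau>"
      using assms(5) \<open>h \<in> c\<close> by (auto simp: conformal_metric_def)
    have "pseudo_riemannian_metric \<A> h"
      using assms(4) \<open>h \<in> c\<close> by (simp add: conformal_class_def)
    from scaled_curveI[OF assms(2) this assms(5) \<tau> assms(7,8) that(1)] sg[OF that(1)] that(3,4)
    show ?thesis
      by (rule wedge_zero_iff)
  qed
  have "g \<in> c"
    using mem_conformal_class_self[OF assms(2,3)] assms(4) by simp
  show ?thesis
  proof
    assume "unparametrised_geodesic \<A> g S \<gamma>"
    then show "\<forall>t\<in>S. \<forall>\<phi>\<in>\<A>. \<gamma> t \<in> chart_dom \<phi> \<longrightarrow> (\<forall>h\<in>c. \<forall>J. I_wedge_Sigma G \<sigma> S \<gamma> \<phi> h t J = 0)"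
      unfolding unparametrised_geodesic_def using wedge by blast
  next
    assume 0: "\<forall>t\<in>S. \<forall>\<phi>\<in>\<A>. \<gamma> t \<in> chart_dom \<phi> \<longrightarrow> (\<forall>h\<in>c. \<forall>J. I_wedge_Sigma G \<sigma> S \<gamma> \<phi> h t J = 0)"
    show "unparametrised_geodesic \<A> g S \<gamma>"
      unfolding unparametrised_geodesic_def
    proof
      fix t assume t: "t \<in> S"
      have acc: "\<exists>k. acceleration g S \<gamma> \<phi> t = k *\<^sub>R velocity S \<gamma> \<phi> t" if "\<phi> \<in> \<A>" "\<gamma> t \<in> chart_dom \<phi>" for \<phi>
        \<comment> \<open>The vanishing in the single scale \<open>g\<close> is enough for this
          direction.\<close>
        using 0 t that \<open>g \<in> c\<close> wedge by blast
      have "\<gamma> t \<in> carrier \<A>"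
        using assms(7) t unfolding smooth_regular_curve_def by blast
      then obtain \<phi> where \<phi>: "\<phi> \<in> \<A>" "\<gamma> t \<in> chart_dom \<phi>"
        unfolding carrier_def by blast
      \<comment> \<open>The factor found in one chart around the point is the candidate for all of
        them.\<close>
      obtain k where k: "acceleration g S \<gamma> \<phi> t = k *\<^sub>R velocity S \<gamma> \<phi> t"
        using acc[OF \<phi>] ..
      interpret \<phi>: scaled_curve \<A> \<phi> G g "\<sigma> \<phi>" S \<gamma>
        by (rule sg[OF \<phi>(1)])
      \<comment> \<open>The hypothesis excludes null velocities for \<open>G\<close>; the positive
        factor carries this over to \<open>g\<close>.\<close>
      have "speed_sq g S \<gamma> \<phi> t = inverse ((\<sigma> \<phi> (\<gamma> t))\<^sup>2) * speed_sq G S \<gamma> \<phi> t"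
        by (simp add: speed_sq_def \<phi>.scale[OF \<phi>(2)] flip: scaleR_matrix_vector_assoc)
      then have nonnull: "speed_sq g S \<gamma> \<phi> t \<noteq> 0"
        using \<phi>.scale_pos[OF \<phi>(2)] \<phi>.nonnull[of t] t \<phi>(2) by (simp add: \<phi>.dom_def)
      have "acceleration g S \<gamma> \<psi> t = k *\<^sub>R velocity S \<gamma> \<psi> t" if \<psi>: "\<psi> \<in> \<A>" "\<gamma> t \<in> chart_dom \<psi>" for \<psi>
      proof -
        interpret \<psi>: scaled_curve \<A> \<psi> G g "\<sigma> \<psi>" S \<gamma>
          by (rule sg[OF \<psi>(1)])
        have "symmetric_form \<A> 0 g"
          using assms(3) by (simp add: pseudo_riemannian_metric_def)
        moreover obtain l where "acceleration g S \<gamma> \<psi> t = l *\<^sub>R velocity S \<gamma> \<psi> t"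
          using acc[OF \<psi>] ..
        ultimately show ?thesis
          using geodesic_factor_unique[OF \<phi>.HC.metric_curve_axioms \<psi>.HC.metric_curve_axioms _ t \<phi>(2) \<psi>(2) nonnull k]
          by metis
      qed
      then show "\<exists>k. \<forall>\<phi>\<in>\<A>. \<gamma> t \<in> chart_dom \<phi> \<longrightarrow> acceleration g S \<gamma> \<phi> t = k *\<^sub>R velocity S \<gamma> \<phi> t"
        by blast
    qed
  qed
qed

end
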